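(* There exist no proper biharmonic pseudo-umbilical Riemannian maps $F$ from a Riemannian manifold $(M_1,g_1)$ to a space form $(M_2(c),g_2)$ of constant sectional curvature $c\le 0$ such that the distribution $\ker F_*$ is minimal and the mean curvature vector field $H_2$ of $\operatorname{range}F_*$ is parallel.
   Context: All manifolds and maps are smooth. A smooth map $F:(M_1,g_1)\to(M_2,g_2)$ of Riemannian manifolds with $\operatorname{rank}F>0$ is a Riemannian map if at every $p\in M_1$ the restriction of $F_{*p}$ to $(\ker F_{*p})^\perp$ is a linear isometry onto $\operatorname{range}F_{*p}\subset T_{F(p)}M_2$. Isometric immersions and Riemannian submersions are special cases. $(\operatorname{range}F_* )^\perp$ is the orthogonal complement of $\operatorname{range}F_*$ in $F^{-1}TM_2$; $m_2=\operatorname{rank}F$ (constant) and $m_1=\dim(\ker F_* )$. $\nabla$ is the Levi-Civita connection of $M_1$ and $\nabla^F$ is the pullback to $F^{-1}TM_2$ of that of $M_2$. The second fundamental form is $(\nabla F_* )(X,Y)=\nabla^F_XF_*(Y)-F_*(\nabla_XY)$; it takes values in $(\operatorname{range}F_* )^\perp$ for $X,Y\in\Gamma((\ker F_* )^\perp)$. The tension field is $\tau(F)=\operatorname{trace}_{g_1}(\nabla F_* )$; $F$ is harmonic if $\tau(F)=0$. $F$ is biharmonic if $\tau^2(F)=-\Delta^F\tau(F)-\operatorname{trace}_{g_1}R^2(F_*(\cdot),\tau(F))F_*(\cdot)=0$, where $\Delta^F=-\operatorname{trace}_{g_1}(\nabla^F\nabla^F-\nabla^F_{\nabla})$ and $R^2$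 is the curvature tensor of $M_2$; on a space form, $R^2(X,Y)Z=c\{g_2(Y,Z)X-g_2(X,Z)Y\}$. Proper biharmonic means biharmonic and not harmonic. $\ker F_*$ is minimal if its mean curvature vector field $\mu^{\ker F_*}=\frac1{m_1}\sum_{j=1}^{m_1}\mathcal H(\nabla_{\tilde e_j}\tilde e_j)$ vanishes, where $\{\tilde e_j\}$ is a local orthonormal frame of $\ker F_*$ and $\mathcal H$ is the orthogonal projection onto $(\ker F_* )^\perp$ (taken as $0$ if $m_1=0$). $H_2=\frac1{m_2}\sum_{i=1}^{m_2}(\nabla F_* )(e_i,e_i)$ for a local orthonormal frame $\{e_i\}$ of $(\ker F_* )^\perp$; it is a section of $(\operatorname{range}F_* )^\perp$. For a section $V$ of $(\operatorname{range}F_* )^\perp$, $\nabla^{F\perp}_XV$ is the orthogonal projection of $\nabla^F_XV$ on $(\operatorname{range}F_* )^\perp$, and for $X\in\Gamma((\ker F_* )^\perp)$, $A_VF_*X$ is minus the $\operatorname{range}F_*$-component of $\nabla^F_XV$. $H_2$ is parallel if $\nabla^{F\perp}_XH_2=0$ for all $X\in\Gamma(TM_1)$. $F$ is pseudo-umbilical if there is $\lambda\in C^\infty(M_1)$ with $A_{H_2}F_*(X)=\lambda F_*(X)$ for all $X\in\Gamma((\ker F_* )^\perp)$. *)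

theory Defs
  imports "HOL-Analysis.Analysis"
begin

section \<open>Smooth functions on open subsets of Euclidean spaces\<close>

primrec Ck_on :: "nat \<Rightarrow> ('e::euclidean_space \<Rightarrow> 'v::real_normed_vector) \<Rightarrow> 'e set \<Rightarrow> bool" where
  "Ck_on 0 f S \<longleftrightarrow> continuous_on S f"
| "Ck_on (Suc k) f S \<longleftrightarrow>
     f differentiable_on S \<and> (\<forall>v. Ck_on k (\<lambda>x. frechet_derivative f (at x) v) S)"

definition smooth_on :: "('e::euclidean_space \<Rightarrow> 'v::real_normed_vector) \<Rightarrow> 'e set \<Rightarrow> bool" where
  "smooth_on f S \<longleftrightarrow> (\<forall>k. Ck_on k f S)"


section \<open>Riemannian manifolds\<close>

text \<open>
  A manifold is given by a topological space and an atlas of charts \<open>(U, \<phi>)\<close> with values in a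
  Euclidean space.  Tensor fields are given classically, by their components in every chart
  together with the transformation law: the metric in the chart \<open>c\<close> at the coordinate point \<open>x\<close>
  is \<open>metric M c x\<close>, and \<open>conn M c x u v\<close> is \<open>\<nabla>\<close> applied to the vector fields with constant
  coordinates \<open>u\<close>, \<open>v\<close> (the Christoffel symbols).  A tangent vector at a point is its coordinate
  vector in a chart round the point, and a vector field on the domain of a chart is a function
  from coordinates to coordinates.  Everything below is invariant under the choice of charts, and
  a property of points is required in every chart (or pair of charts) containing the point.
  By the fundamental theorem of Riemannian geometry the Levi-Civita connection exists and is
  unique on the chart images, so that the field \<open>conn\<close> is no additional structure.
\<close>

type_synonym ('a, 'e) chart = "'a set \<times> ('a \<Rightarrow> 'e)"

record ('a, 'e) riem =
  topo :: "'a topology"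
  atlas :: "('a, 'e) chart set"
  metric :: "('a, 'e) chart \<Rightarrow> 'e \<Rightarrow> 'e \<Rightarrow> 'e \<Rightarrow> real"
  conn :: "('a, 'e) chart \<Rightarrow> 'e \<Rightarrow> 'e \<Rightarrow> 'e \<Rightarrow> 'e"

definition cdom :: "('a, 'e) chart \<Rightarrow> 'a set" where
  "cdom c = fst c"

definition cimg :: "('a, 'e) chart \<Rightarrow> 'e set" where
  "cimg c = snd c ` fst c"

definition cinv :: "('a, 'e) chart \<Rightarrow> 'e \<Rightarrow> 'a" where
  "cinv c = inv_into (fst c) (snd c)"

definition is_chart :: "'a topology \<Rightarrow> ('a, 'e::euclidean_space) chart \<Rightarrow> bool" where
  "is_chart X c \<longleftrightarrow> openin X (cdom c) \<and> open (cimg c)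
     \<and> homeomorphic_map (subtopology X (cdom c)) (top_of_set (cimg c)) (snd c)"

definition transition :: "('a, 'e) chart \<Rightarrow> ('a, 'e) chart \<Rightarrow> 'e \<Rightarrow> 'e" where
  "transition c d = (\<lambda>x. snd d (cinv c x))"

definition overlap :: "('a, 'e) chart \<Rightarrow> ('a, 'e) chart \<Rightarrow> 'e set" where
  "overlap c d = {x \<in> cimg c. cinv c x \<in> cdom d}"

definition smooth_manifold :: "('a, 'e::euclidean_space) riem \<Rightarrow> bool" where
  "smooth_manifold M \<longleftrightarrow>
     Hausdorff_space (topo M) \<and> second_countable (topo M)
     \<and> (\<forall>c\<in>atlas M. is_chart (topo M) c)
     \<and> (\<Union>c\<in>atlas M. cdom c) = topspace (topo M)
     \<and> (\<forall>c\<in>atlas M. \<forall>d\<in>atlas M. smooth_on (transition c d) (overlap c d))"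

definition riemannian_metric :: "('a, 'e::euclidean_space) riem \<Rightarrow> bool" where
  "riemannian_metric M \<longleftrightarrow>
     (\<forall>c\<in>atlas M.
        (\<forall>x\<in>cimg c. bilinear (metric M c x)
            \<and> (\<forall>u v. metric M c x u v = metric M c x v u)
            \<and> (\<forall>u. u \<noteq> 0 \<longrightarrow> metric M c x u u > 0))
        \<and> (\<forall>u v. smooth_on (\<lambda>x. metric M c x u v) (cimg c)))
     \<and> (\<forall>c\<in>atlas M. \<forall>d\<in>atlas M. \<forall>x\<in>overlap c d. \<forall>u v.
          metric M d (transition c d x)
              (frechet_derivative (transition c d) (at x) u)
              (frechet_derivative (transition c d) (at x) v)
            = metric M c x u v)"

text \<open>The last clause is the classical transformation law of the Christoffel symbols; it says
  that \<open>\<nabla>\<^sub>X Y\<close>, computed in two charts, is the same vector field.\<close>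

definition affine_connection :: "('a, 'e::euclidean_space) riem \<Rightarrow> bool" where
  "affine_connection M \<longleftrightarrow>
     (\<forall>c\<in>atlas M. (\<forall>x\<in>cimg c. bilinear (conn M c x))
        \<and> (\<forall>u v. smooth_on (\<lambda>x. conn M c x u v) (cimg c)))
     \<and> (\<forall>c\<in>atlas M. \<forall>d\<in>atlas M. \<forall>x\<in>overlap c d. \<forall>u v.
          conn M d (transition c d x)
              (frechet_derivative (transition c d) (at x) u)
              (frechet_derivative (transition c d) (at x) v)
            = frechet_derivative (transition c d) (at x) (conn M c x u v)
              - frechet_derivative
                  (\<lambda>y. frechet_derivative (transition c d) (at y) v) (at x) u)"

definition nabla :: "('a, 'e::euclidean_space) riem \<Rightarrow> ('a, 'e) chart
    \<Rightarrow> ('e \<Rightarrow> 'e) \<Rightarrow> ('e \<Rightarrow> 'e) \<Rightarrow> 'e \<Rightarrow> 'e" where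
  "nabla M c X Y x = frechet_derivative Y (at x) (X x) + conn M c x (X x) (Y x)"

definition lie_bracket :: "('e::euclidean_space \<Rightarrow> 'e) \<Rightarrow> ('e \<Rightarrow> 'e) \<Rightarrow> 'e \<Rightarrow> 'e" where
  "lie_bracket X Y x = frechet_derivative Y (at x) (X x) - frechet_derivative X (at x) (Y x)"

definition levi_civita :: "('a, 'e::euclidean_space) riem \<Rightarrow> bool" where
  "levi_civita M \<longleftrightarrow> affine_connection M
     \<and> (\<forall>c\<in>atlas M. \<forall>X Y Z.
          smooth_on X (cimg c) \<longrightarrow> smooth_on Y (cimg c) \<longrightarrow> smooth_on Z (cimg c) \<longrightarrow>
          (\<forall>x\<in>cimg c.
             nabla M c X Y x - nabla M c Y X x = lie_bracket X Y x
             \<and> frechet_derivative (\<lambda>y. metric M c y (Y y) (Z y)) (at x) (X x)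
               = metric M c x (nabla M c X Y x) (Z x) + metric M c x (Y x) (nabla M c X Z x)))"

definition riemannian_manifold :: "('a, 'e::euclidean_space) riem \<Rightarrow> bool" where
  "riemannian_manifold M \<longleftrightarrow> smooth_manifold M \<and> riemannian_metric M \<and> levi_civita M"

definition curv :: "('a, 'e::euclidean_space) riem \<Rightarrow> ('a, 'e) chart
    \<Rightarrow> ('e \<Rightarrow> 'e) \<Rightarrow> ('e \<Rightarrow> 'e) \<Rightarrow> ('e \<Rightarrow> 'e) \<Rightarrow> 'e \<Rightarrow> 'e" where
  "curv M c X Y Z x =
     nabla M c X (nabla M c Y Z) x - nabla M c Y (nabla M c X Z) x
     - nabla M c (lie_bracket X Y) Z x"

text \<open>The value of a tensor on tangent vectors is computed, here and below, on their extensions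
  to vector fields with constant coordinates.\<close>

definition curv_at :: "('a, 'e::euclidean_space) riem \<Rightarrow> ('a, 'e) chart
    \<Rightarrow> 'e \<Rightarrow> 'e \<Rightarrow> 'e \<Rightarrow> 'e \<Rightarrow> 'e" where
  "curv_at M c x u v w = curv M c (\<lambda>_. u) (\<lambda>_. v) (\<lambda>_. w) x"

definition sectional_curvature :: "('a, 'e::euclidean_space) riem \<Rightarrow> ('a, 'e) chart
    \<Rightarrow> 'e \<Rightarrow> 'e \<Rightarrow> 'e \<Rightarrow> real" where
  "sectional_curvature M c x u v =
     metric M c x (curv_at M c x u v v) u
       / (metric M c x u u * metric M c x v v - (metric M c x u v)\<^sup>2)"

definition space_form :: "('a, 'e::euclidean_space) riem \<Rightarrow> real \<Rightarrow> bool" where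
  "space_form M k \<longleftrightarrow> riemannian_manifold M
     \<and> (\<forall>c\<in>atlas M. \<forall>x\<in>cimg c. \<forall>u v.
          u \<noteq> v \<and> independent {u, v} \<longrightarrow> sectional_curvature M c x u v = k)"


section \<open>Linear algebra with respect to a given inner product\<close>

definition orthonormal_basis :: "('e::euclidean_space \<Rightarrow> 'e \<Rightarrow> real) \<Rightarrow> 'e set \<Rightarrow> 'e set \<Rightarrow> bool" where
  "orthonormal_basis g S E \<longleftrightarrow>
     finite E \<and> span E = S \<and> (\<forall>u\<in>E. \<forall>v\<in>E. g u v = (if u = v then 1 else 0))"

text \<open>The trace of a bilinear form over a subspace; it does not depend on the basis.\<close>

definition trace_on :: "('e::euclidean_space \<Rightarrow> 'e \<Rightarrow> real) \<Rightarrow> 'e set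
    \<Rightarrow> ('e \<Rightarrow> 'e \<Rightarrow> 'v::real_vector) \<Rightarrow> 'v" where
  "trace_on g S B = (\<Sum>e\<in>(SOME E. orthonormal_basis g S E). B e e)"

definition orth :: "('e::euclidean_space \<Rightarrow> 'e \<Rightarrow> real) \<Rightarrow> 'e set \<Rightarrow> 'e set" where
  "orth g S = {u. \<forall>v\<in>S. g u v = 0}"

definition oproj :: "('e::euclidean_space \<Rightarrow> 'e \<Rightarrow> real) \<Rightarrow> 'e set \<Rightarrow> 'e \<Rightarrow> 'e" where
  "oproj g S u = (THE w. w \<in> S \<and> u - w \<in> orth g S)"


section \<open>Maps between Riemannian manifolds\<close>

text \<open>All objects attached to a map \<open>F\<close> are expressed in a chart \<open>c\<close> of the source and a chart
  \<open>d\<close> of the target, on the set \<open>ldom c d F\<close> of coordinates of points of the domain of \<open>c\<close>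
  that \<open>F\<close> maps into the domain of \<open>d\<close>.  A section of \<open>F\<^sup>-\<^sup>1 TM\<^sub>2\<close> is there a function
  from source coordinates to target coordinate vectors.\<close>

definition loc :: "('a, 'e) chart \<Rightarrow> ('b, 'f) chart \<Rightarrow> ('a \<Rightarrow> 'b) \<Rightarrow> 'e \<Rightarrow> 'f" where
  "loc c d F = (\<lambda>x. snd d (F (cinv c x)))"

definition ldom :: "('a, 'e) chart \<Rightarrow> ('b, 'f) chart \<Rightarrow> ('a \<Rightarrow> 'b) \<Rightarrow> 'e set" where
  "ldom c d F = {x \<in> cimg c. F (cinv c x) \<in> cdom d}"

definition smooth_map :: "('a, 'e::euclidean_space) riem \<Rightarrow> ('b, 'f::euclidean_space) riem
    \<Rightarrow> ('a \<Rightarrow> 'b) \<Rightarrow> bool" where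
  "smooth_map M N F \<longleftrightarrow> continuous_map (topo M) (topo N) F
     \<and> (\<forall>c\<in>atlas M. \<forall>d\<in>atlas N. smooth_on (loc c d F) (ldom c d F))"

definition smooth_function :: "('a, 'e::euclidean_space) riem \<Rightarrow> ('a \<Rightarrow> real) \<Rightarrow> bool" where
  "smooth_function M h \<longleftrightarrow> (\<forall>c\<in>atlas M. smooth_on (\<lambda>x. h (cinv c x)) (cimg c))"

definition tmap :: "('a, 'e::euclidean_space) chart \<Rightarrow> ('b, 'f::euclidean_space) chart
    \<Rightarrow> ('a \<Rightarrow> 'b) \<Rightarrow> 'e \<Rightarrow> 'e \<Rightarrow> 'f" where
  "tmap c d F x = frechet_derivative (loc c d F) (at x)"

definition ker_at :: "('a, 'e::euclidean_space) chart \<Rightarrow> ('b, 'f::euclidean_space) chart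
    \<Rightarrow> ('a \<Rightarrow> 'b) \<Rightarrow> 'e \<Rightarrow> 'e set" where
  "ker_at c d F x = {u. tmap c d F x u = 0}"

definition hor_at :: "('a, 'e::euclidean_space) riem
    \<Rightarrow> ('a, 'e) chart \<Rightarrow> ('b, 'f::euclidean_space) chart \<Rightarrow> ('a \<Rightarrow> 'b) \<Rightarrow> 'e \<Rightarrow> 'e set" where
  "hor_at M c d F x = orth (metric M c x) (ker_at c d F x)"

definition range_at :: "('a, 'e::euclidean_space) chart \<Rightarrow> ('b, 'f::euclidean_space) chart
    \<Rightarrow> ('a \<Rightarrow> 'b) \<Rightarrow> 'e \<Rightarrow> 'f set" where
  "range_at c d F x = range (tmap c d F x)"

definition range_perp_at :: "('b, 'f::euclidean_space) riem
    \<Rightarrow> ('a, 'e::euclidean_space) chart \<Rightarrow> ('b, 'f) chart \<Rightarrow> ('a \<Rightarrow> 'b) \<Rightarrow> 'e \<Rightarrow> 'f set" where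
  "range_perp_at N c d F x = orth (metric N d (loc c d F x)) (range_at c d F x)"

definition riemannian_map :: "('a, 'e::euclidean_space) riem \<Rightarrow> ('b, 'f::euclidean_space) riem
    \<Rightarrow> ('a \<Rightarrow> 'b) \<Rightarrow> bool" where
  "riemannian_map M N F \<longleftrightarrow> smooth_map M N F
     \<and> (\<exists>m>0. \<forall>c\<in>atlas M. \<forall>d\<in>atlas N. \<forall>x\<in>ldom c d F. dim (range_at c d F x) = m)
     \<and> (\<forall>c\<in>atlas M. \<forall>d\<in>atlas N. \<forall>x\<in>ldom c d F.
          tmap c d F x ` hor_at M c d F x = range_at c d F x
          \<and> (\<forall>u\<in>hor_at M c d F x. \<forall>v\<in>hor_at M c d F x.
               metric N d (loc c d F x) (tmap c d F x u) (tmap c d F x v) = metric M c x u v))"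

text \<open>The pullback connection: on \<open>V = Y \<circ> F\<close> it gives \<open>\<nabla>\<^sup>N Y\<close> in the direction
  \<open>F\<^sub>* X\<close>, and it satisfies the Leibniz rule.\<close>

definition nablaF :: "('b, 'f::euclidean_space) riem
    \<Rightarrow> ('a, 'e::euclidean_space) chart \<Rightarrow> ('b, 'f) chart \<Rightarrow> ('a \<Rightarrow> 'b)
    \<Rightarrow> ('e \<Rightarrow> 'e) \<Rightarrow> ('e \<Rightarrow> 'f) \<Rightarrow> 'e \<Rightarrow> 'f" where
  "nablaF N c d F X V x =
     frechet_derivative V (at x) (X x)
     + conn N d (loc c d F x) (tmap c d F x (X x)) (V x)"

definition second_fund :: "('a, 'e::euclidean_space) riem \<Rightarrow> ('b, 'f::euclidean_space) riem
    \<Rightarrow> ('a, 'e) chart \<Rightarrow> ('b, 'f) chart \<Rightarrow> ('a \<Rightarrow> 'b)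
    \<Rightarrow> ('e \<Rightarrow> 'e) \<Rightarrow> ('e \<Rightarrow> 'e) \<Rightarrow> 'e \<Rightarrow> 'f" where
  "second_fund M N c d F X Y x =
     nablaF N c d F X (\<lambda>y. tmap c d F y (Y y)) x - tmap c d F x (nabla M c X Y x)"

definition second_fund_at :: "('a, 'e::euclidean_space) riem \<Rightarrow> ('b, 'f::euclidean_space) riem
    \<Rightarrow> ('a, 'e) chart \<Rightarrow> ('b, 'f) chart \<Rightarrow> ('a \<Rightarrow> 'b) \<Rightarrow> 'e \<Rightarrow> 'e \<Rightarrow> 'e \<Rightarrow> 'f" where
  "second_fund_at M N c d F x u v = second_fund M N c d F (\<lambda>_. u) (\<lambda>_. v) x"

definition tension :: "('a, 'e::euclidean_space) riem \<Rightarrow> ('b, 'f::euclidean_space) riem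
    \<Rightarrow> ('a, 'e) chart \<Rightarrow> ('b, 'f) chart \<Rightarrow> ('a \<Rightarrow> 'b) \<Rightarrow> 'e \<Rightarrow> 'f" where
  "tension M N c d F x = trace_on (metric M c x) UNIV (second_fund_at M N c d F x)"

definition harmonic :: "('a, 'e::euclidean_space) riem \<Rightarrow> ('b, 'f::euclidean_space) riem
    \<Rightarrow> ('a \<Rightarrow> 'b) \<Rightarrow> bool" where
  "harmonic M N F \<longleftrightarrow>
     (\<forall>c\<in>atlas M. \<forall>d\<in>atlas N. \<forall>x\<in>ldom c d F. tension M N c d F x = 0)"

definition hessianF :: "('a, 'e::euclidean_space) riem \<Rightarrow> ('b, 'f::euclidean_space) riem
    \<Rightarrow> ('a, 'e) chart \<Rightarrow> ('b, 'f) chart \<Rightarrow> ('a \<Rightarrow> 'b)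
    \<Rightarrow> ('e \<Rightarrow> 'e) \<Rightarrow> ('e \<Rightarrow> 'e) \<Rightarrow> ('e \<Rightarrow> 'f) \<Rightarrow> 'e \<Rightarrow> 'f" where
  "hessianF M N c d F X Y V x =
     nablaF N c d F X (nablaF N c d F Y V) x - nablaF N c d F (nabla M c X Y) V x"

definition laplaceF :: "('a, 'e::euclidean_space) riem \<Rightarrow> ('b, 'f::euclidean_space) riem
    \<Rightarrow> ('a, 'e) chart \<Rightarrow> ('b, 'f) chart \<Rightarrow> ('a \<Rightarrow> 'b) \<Rightarrow> ('e \<Rightarrow> 'f) \<Rightarrow> 'e \<Rightarrow> 'f" where
  "laplaceF M N c d F V x =
     - trace_on (metric M c x) UNIV (\<lambda>u v. hessianF M N c d F (\<lambda>_. u) (\<lambda>_. v) V x)"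

definition bitension :: "('a, 'e::euclidean_space) riem \<Rightarrow> ('b, 'f::euclidean_space) riem
    \<Rightarrow> ('a, 'e) chart \<Rightarrow> ('b, 'f) chart \<Rightarrow> ('a \<Rightarrow> 'b) \<Rightarrow> 'e \<Rightarrow> 'f" where
  "bitension M N c d F x =
     - laplaceF M N c d F (tension M N c d F) x
     - trace_on (metric M c x) UNIV
         (\<lambda>u v. curv_at N d (loc c d F x)
                  (tmap c d F x u) (tension M N c d F x) (tmap c d F x v))"

definition biharmonic :: "('a, 'e::euclidean_space) riem \<Rightarrow> ('b, 'f::euclidean_space) riem
    \<Rightarrow> ('a \<Rightarrow> 'b) \<Rightarrow> bool" where
  "biharmonic M N F \<longleftrightarrow>
     (\<forall>c\<in>atlas M. \<forall>d\<in>atlas N. \<forall>x\<in>ldom c d F. bitension M N c d F x = 0)"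

definition proper_biharmonic :: "('a, 'e::euclidean_space) riem
    \<Rightarrow> ('b, 'f::euclidean_space) riem \<Rightarrow> ('a \<Rightarrow> 'b) \<Rightarrow> bool" where
  "proper_biharmonic M N F \<longleftrightarrow> biharmonic M N F \<and> \<not> harmonic M N F"


section \<open>Minimal kernel, parallel mean curvature, pseudo-umbilicity\<close>

definition ker_frame :: "('a, 'e::euclidean_space) riem
    \<Rightarrow> ('a, 'e) chart \<Rightarrow> ('b, 'f::euclidean_space) chart \<Rightarrow> ('a \<Rightarrow> 'b)
    \<Rightarrow> 'e set \<Rightarrow> nat \<Rightarrow> (nat \<Rightarrow> 'e \<Rightarrow> 'e) \<Rightarrow> bool" where
  "ker_frame M c d F U m e \<longleftrightarrow> open U \<and> U \<subseteq> ldom c d F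
     \<and> (\<forall>j<m. smooth_on (e j) U)
     \<and> (\<forall>y\<in>U. span ((\<lambda>j. e j y) ` {..<m}) = ker_at c d F y
          \<and> (\<forall>i<m. \<forall>j<m. metric M c y (e i y) (e j y) = (if i = j then 1 else 0)))"

text \<open>\<open>mu\<close> is the mean curvature vector of the kernel distribution at \<open>x\<close>.  For a Riemannian map
  a frame exists round every point, as the rank is constant, and \<open>mu\<close> does not depend on it;
  for \<open>m = 0\<close> the definition gives \<open>mu = 0\<close>.\<close>

definition ker_mean_curvature :: "('a, 'e::euclidean_space) riem
    \<Rightarrow> ('a, 'e) chart \<Rightarrow> ('b, 'f::euclidean_space) chart \<Rightarrow> ('a \<Rightarrow> 'b) \<Rightarrow> 'e \<Rightarrow> 'e \<Rightarrow> bool" where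
  "ker_mean_curvature M c d F x mu \<longleftrightarrow>
     (\<exists>U m e. x \<in> U \<and> ker_frame M c d F U m e
        \<and> mu = (1 / real m) *\<^sub>R
            (\<Sum>j<m. oproj (metric M c x) (hor_at M c d F x) (nabla M c (e j) (e j) x)))"

definition minimal_kernel :: "('a, 'e::euclidean_space) riem
    \<Rightarrow> ('b, 'f::euclidean_space) riem \<Rightarrow> ('a \<Rightarrow> 'b) \<Rightarrow> bool" where
  "minimal_kernel M N F \<longleftrightarrow>
     (\<forall>c\<in>atlas M. \<forall>d\<in>atlas N. \<forall>x\<in>ldom c d F. ker_mean_curvature M c d F x 0)"

definition mean_curvature :: "('a, 'e::euclidean_space) riem \<Rightarrow> ('b, 'f::euclidean_space) riem
    \<Rightarrow> ('a, 'e) chart \<Rightarrow> ('b, 'f) chart \<Rightarrow> ('a \<Rightarrow> 'b) \<Rightarrow> 'e \<Rightarrow> 'f" where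
  "mean_curvature M N c d F x =
     (1 / real (dim (range_at c d F x))) *\<^sub>R
       trace_on (metric M c x) (hor_at M c d F x) (second_fund_at M N c d F x)"

definition nablaF_perp :: "('b, 'f::euclidean_space) riem
    \<Rightarrow> ('a, 'e::euclidean_space) chart \<Rightarrow> ('b, 'f) chart \<Rightarrow> ('a \<Rightarrow> 'b)
    \<Rightarrow> ('e \<Rightarrow> 'e) \<Rightarrow> ('e \<Rightarrow> 'f) \<Rightarrow> 'e \<Rightarrow> 'f" where
  "nablaF_perp N c d F X V x =
     oproj (metric N d (loc c d F x)) (range_perp_at N c d F x) (nablaF N c d F X V x)"

text \<open>\<open>shape_op N c d F V X\<close> is \<open>A\<^sub>V F\<^sub>* X\<close>.\<close>

definition shape_op :: "('b, 'f::euclidean_space) riem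
    \<Rightarrow> ('a, 'e::euclidean_space) chart \<Rightarrow> ('b, 'f) chart \<Rightarrow> ('a \<Rightarrow> 'b)
    \<Rightarrow> ('e \<Rightarrow> 'f) \<Rightarrow> ('e \<Rightarrow> 'e) \<Rightarrow> 'e \<Rightarrow> 'f" where
  "shape_op N c d F V X x =
     - oproj (metric N d (loc c d F x)) (range_at c d F x) (nablaF N c d F X V x)"

text \<open>Both operators depend on \<open>X\<close> only through its value at the point, so vector fields are
  replaced by tangent vectors.\<close>

definition parallel_mean_curvature :: "('a, 'e::euclidean_space) riem
    \<Rightarrow> ('b, 'f::euclidean_space) riem \<Rightarrow> ('a \<Rightarrow> 'b) \<Rightarrow> bool" where
  "parallel_mean_curvature M N F \<longleftrightarrow>
     (\<forall>c\<in>atlas M. \<forall>d\<in>atlas N. \<forall>x\<in>ldom c d F. \<forall>u.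
        nablaF_perp N c d F (\<lambda>_. u) (mean_curvature M N c d F) x = 0)"

definition pseudo_umbilical :: "('a, 'e::euclidean_space) riem
    \<Rightarrow> ('b, 'f::euclidean_space) riem \<Rightarrow> ('a \<Rightarrow> 'b) \<Rightarrow> bool" where
  "pseudo_umbilical M N F \<longleftrightarrow>
     (\<exists>lam. smooth_function M lam
        \<and> (\<forall>c\<in>atlas M. \<forall>d\<in>atlas N. \<forall>x\<in>ldom c d F. \<forall>u\<in>hor_at M c d F x.
             shape_op N c d F (mean_curvature M N c d F) (\<lambda>_. u) x
               = lam (cinv c x) *\<^sub>R tmap c d F x u))"

end

theory Submission
  imports Defs
begin

text \<open>
  Since \<open>ker F\<^sub>*\<close> is minimal, \<open>\<tau> = \<tau>(F)\<close> is a positive multiple of \<open>H\<^sub>2\<close>; it is a section of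
  \<open>(range F\<^sub>*)\<^sup>\<bottom>\<close> whose derivatives \<open>\<nabla>\<^sub>X \<tau>\<close> lie in \<open>range F\<^sub>*\<close>, because \<open>H\<^sub>2\<close> is parallel.
  So \<open>\<langle>\<nabla>\<^sub>X \<tau>, \<tau>\<rangle> = 0\<close>, and one more differentiation gives
  \<open>\<langle>\<nabla>\<^sup>2\<^sub>X\<^sub>,\<^sub>X \<tau>, \<tau>\<rangle> = - |\<nabla>\<^sub>X \<tau>|\<^sup>2\<close>.  Pairing the biharmonic equation with \<open>\<tau>\<close> yields
  \<open>\<Sum>\<^sub>e (c |\<tau>|\<^sup>2 |F\<^sub>* e|\<^sup>2 - |\<nabla>\<^sub>e \<tau>|\<^sup>2) = 0\<close> over an orthonormal basis, and \<open>c \<le> 0\<close> forces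
  \<open>\<nabla>\<tau> = 0\<close>.  Differentiating \<open>\<langle>\<tau>, F\<^sub>* Y\<rangle> = 0\<close> then shows that \<open>\<tau>\<close> is orthogonal to the whole
  second fundamental form, in particular to its own trace, whence \<open>\<tau> = 0\<close>.
\<close>

section \<open>Differential calculus\<close>

text \<open>Since \<open>S\<close> is open, \<open>f\<close> and \<open>g\<close> agree near each
  point of \<open>S\<close>, so agreement passes to the derivatives and the induction continues with
  them.\<close>

lemma Ck_on_cong:
  assumes "open S" "Ck_on k f S" "\<And>x. x \<in> S \<Longrightarrow> f x = g x"
  shows "Ck_on k g S"
  using assms(2,3)
proof (induction k arbitrary: f g)
  case 0
  then show ?case by (metis Ck_on.simps(1) continuous_on_cong)
next
  case (Suc k)
  have "g differentiable_on S"
    unfolding differentiable_on_def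
  proof
    fix x assume "x \<in> S"
    then have "f differentiable at x within S" using Suc.prems(1) by (simp add: differentiable_on_def)
    then show "g differentiable at x within S"
      by (rule differentiable_transform_within[OF _ zero_less_one \<open>x \<in> S\<close>]) (rule Suc.prems(2))
  qed
  moreover have "Ck_on k (\<lambda>x. frechet_derivative g (at x) v) S" for v
  proof (rule Suc.IH)
    show "Ck_on k (\<lambda>x. frechet_derivative f (at x) v) S" using Suc.prems by simp
    fix x assume "x \<in> S"
    moreover have "f differentiable at x"
      using Suc.prems(1) \<open>x \<in> S\<close> \<open>open S\<close> by (simp add: differentiable_on_eq_differentiable_at)
    ultimately show "frechet_derivative f (at x) v = frechet_derivative g (at x) v"
      using frechet_derivative_transform_within_open[of f x S g] assms(1) Suc.prems(2) by simp
  qed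
  ultimately show ?case by simp
qed

lemma Ck_on_differentiable:
  assumes "open S" "Ck_on (Suc k) f S" "x \<in> S"
  shows "f differentiable at x"
  using assms by (simp add: differentiable_on_eq_differentiable_at)

lemma Ck_on_has_derivative:
  assumes "open S" "Ck_on (Suc k) f S" "x \<in> S"
  shows "(f has_derivative frechet_derivative f (at x)) (at x)"
  using Ck_on_differentiable[OF assms] frechet_derivative_works by blast

text \<open>Uniqueness of the derivative identifies \<open>f'\<close> with
  \<open>frechet_derivative\<close> on \<open>S\<close>, so an induction step may exhibit a
  derivative in any convenient closed form.\<close>

lemma Ck_on_SucI:
  assumes "open S" "\<And>x. x \<in> S \<Longrightarrow> (f has_derivative f' x) (at x)"
    "\<And>v. Ck_on k (\<lambda>x. f' x v) S"
  shows "Ck_on (Suc k) f S"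
proof -
  have "f differentiable_on S"
    using assms(2) by (meson differentiable_at_imp_differentiable_on differentiable_def)
  moreover have "Ck_on k (\<lambda>x. frechet_derivative f (at x) v) S" for v
    by (rule Ck_on_cong[OF assms(1) assms(3)[of v]]) (metis assms(2) frechet_derivative_at)
  ultimately show ?thesis by simp
qed

lemma Ck_on_Suc_imp: "Ck_on (Suc k) f S \<Longrightarrow> Ck_on k f S"
proof (induction k arbitrary: f)
  case 0
  then show ?case by (simp add: differentiable_imp_continuous_on)
next
  case (Suc k)
  then show ?case by (metis Ck_on.simps(2))
qed

lemma Ck_on_subset: "Ck_on k f S \<Longrightarrow> T \<subseteq> S \<Longrightarrow> Ck_on k f T"
  by (induction k arbitrary: f) (auto intro: continuous_on_subset differentiable_on_subset)

lemma Ck_on_const: "open S \<Longrightarrow> Ck_on k (\<lambda>x. a) S"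
proof (induction k arbitrary: a)
  case (Suc k)
  show ?case by (rule Ck_on_SucI[where f' = "\<lambda>_ _. 0"]) (auto simp: Suc)
qed simp

lemma Ck_on_add:
  assumes "open S" "Ck_on k f S" "Ck_on k g S"
  shows "Ck_on k (\<lambda>x. f x + g x) S"
  using assms(2,3)
proof (induction k arbitrary: f g)
  case 0
  then show ?case by (simp add: continuous_on_add)
next
  case (Suc k)
  show ?case
  proof (rule Ck_on_SucI[OF assms(1)])
    fix x assume "x \<in> S"
    then show "((\<lambda>x. f x + g x) has_derivative
        (\<lambda>v. frechet_derivative f (at x) v + frechet_derivative g (at x) v)) (at x)"
      by (intro has_derivative_add Ck_on_has_derivative[OF assms(1)]) (use Suc.prems in blast)+
  next
    fix v show "Ck_on k (\<lambda>x. frechet_derivative f (at x) v + frechet_derivative g (at x) v) S"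
      by (rule Suc.IH) (use Suc.prems in auto)
  qed
qed

lemma Ck_on_sum:
  assumes "open S" "\<And>i. i \<in> I \<Longrightarrow> Ck_on k (f i) S"
  shows "Ck_on k (\<lambda>x. \<Sum>i\<in>I. f i x) S"
  using assms(2)
  by (induction I rule: infinite_finite_induct) (auto simp: Ck_on_const Ck_on_add assms(1))

lemma Ck_on_bounded_bilinear:
  assumes B: "bounded_bilinear B" and "open S" "Ck_on k f S" "Ck_on k g S"
  shows "Ck_on k (\<lambda>x. B (f x) (g x)) S"
  using assms(3,4)
proof (induction k arbitrary: f g)
  case 0
  then show ?case by (simp add: bounded_bilinear.continuous_on[OF B])
next
  case (Suc k)
  show ?case
  proof (rule Ck_on_SucI[OF assms(2)])
    fix x assume "x \<in> S"
    then show "((\<lambda>x. B (f x) (g x)) has_derivative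
        (\<lambda>v. B (f x) (frechet_derivative g (at x) v) + B (frechet_derivative f (at x) v) (g x))) (at x)"
      by (intro bounded_bilinear.FDERIV[OF B] Ck_on_has_derivative[OF assms(2)]) (use Suc.prems in blast)+
  next
    fix v show "Ck_on k (\<lambda>x. B (f x) (frechet_derivative g (at x) v) + B (frechet_derivative f (at x) v) (g x)) S"
      by (intro Ck_on_add[OF assms(2)] Suc.IH Ck_on_Suc_imp[OF Suc.prems(1)] Ck_on_Suc_imp[OF Suc.prems(2)])
        (use Suc.prems in auto)
  qed
qed

lemmas Ck_on_scaleR = Ck_on_bounded_bilinear[OF bounded_bilinear_scaleR]
lemmas Ck_on_mult = Ck_on_bounded_bilinear[OF bounded_bilinear_mult]
lemmas Ck_on_inner = Ck_on_bounded_bilinear[OF bounded_bilinear_inner]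

lemma Ck_on_minus:
  assumes "open S" "Ck_on k f S"
  shows "Ck_on k (\<lambda>x. - f x) S"
  using Ck_on_scaleR[OF assms(1) Ck_on_const[OF assms(1), of k "-1::real"] assms(2)] by simp

lemma Ck_on_diff:
  assumes "open S" "Ck_on k f S" "Ck_on k g S"
  shows "Ck_on k (\<lambda>x. f x - g x) S"
  using Ck_on_add[OF assms(1,2) Ck_on_minus[OF assms(1,3)]] by simp


text \<open>The function \<open>p = 1 / sqrt r\<close> satisfies p' = -(1/2) p^3 r', a product of
  \<open>p\<close> with a derivative of \<open>r\<close>; so the regularity of \<open>p\<close> at
  one order gives the next. It serves the normalisation in Gram-Schmidt.\<close>

lemma Ck_on_inverse_sqrt:
  fixes r :: "'e::euclidean_space \<Rightarrow> real"
  assumes "open S" "Ck_on k r S" "\<And>x. x \<in> S \<Longrightarrow> r x > 0"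
  shows "Ck_on k (\<lambda>x. 1 / sqrt (r x)) S"
  using assms(2)
proof (induction k)
  case 0
  then have "continuous_on S r" by simp
  then have "continuous_on S (\<lambda>x. 1 / sqrt (r x))"
    by (intro continuous_on_divide continuous_on_real_sqrt continuous_on_const) (use assms(3) in force)+
  then show ?case by simp
next
  case (Suc k)
  define p where "p = (\<lambda>x. 1 / sqrt (r x))"
  have p: "Ck_on k p S" unfolding p_def using Suc Ck_on_Suc_imp by blast
  show ?case unfolding p_def[symmetric]
  proof (rule Ck_on_SucI[OF assms(1)])
    fix x assume x: "x \<in> S"
    have "((\<lambda>t. 1 / sqrt t) has_real_derivative (- (1/2) * (p x * (p x * p x)))) (at (r x))"
    proof -
      have "((\<lambda>t. inverse (sqrt t)) has_real_derivative
          - (inverse (sqrt (r x)) * (inverse (sqrt (r x)) / 2) * inverse (sqrt (r x)))) (at (r x))"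
        by (rule DERIV_inverse'[OF DERIV_real_sqrt[OF assms(3)[OF x]]]) (use assms(3)[OF x] in simp)
      moreover have "- (t * (t / 2) * t) = - (1 / 2) * (t * (t * t))" for t :: real by simp
      ultimately show ?thesis by (simp only: p_def inverse_eq_divide)
    qed
    then show "(p has_derivative (\<lambda>v. (- (1/2) * (p x * (p x * p x))) * frechet_derivative r (at x) v)) (at x)"
      unfolding p_def
      by (intro has_derivative_eq_rhs[OF DERIV_compose_FDERIV[OF _ Ck_on_has_derivative[OF assms(1) Suc.prems x]]])
        (auto simp: mult.commute)
  next
    fix v
    show "Ck_on k (\<lambda>x. (- (1/2) * (p x * (p x * p x))) * frechet_derivative r (at x) v) S"
      by (intro Ck_on_mult assms(1) p Ck_on_const) (use Suc.prems in auto)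
  qed
qed

lemma linear_eq_sum_Basis:
  fixes f :: "'e::euclidean_space \<Rightarrow> 'v::real_vector"
  assumes "linear f"
  shows "f u = (\<Sum>b\<in>Basis. (u \<bullet> b) *\<^sub>R f b)"
proof -
  have "f u = f (\<Sum>b\<in>Basis. (u \<bullet> b) *\<^sub>R b)" by (simp only: euclidean_representation)
  also have "\<dots> = (\<Sum>b\<in>Basis. (u \<bullet> b) *\<^sub>R f b)"
    by (simp only: linear_sum[OF assms] linear_scale[OF assms])
  finally show ?thesis .
qed

text \<open>In the chain rule the derivative of \<open>g\<close> is taken in a direction that moves
  with \<open>x\<close>. Expanding this direction in \<open>Basis\<close> leaves derivatives of
  \<open>g\<close> in fixed directions, to which the induction hypothesis applies.\<close>

lemma Ck_on_compose:
  fixes f :: "'e::euclidean_space \<Rightarrow> 'f::euclidean_space"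
  assumes "open S" "open T" "Ck_on k f S" "Ck_on k g T" "f ` S \<subseteq> T"
  shows "Ck_on k (\<lambda>x. g (f x)) S"
  using assms(3,4)
proof (induction k arbitrary: g)
  case 0
  then show ?case using continuous_on_compose2 assms(5) by auto
next
  case (Suc k)
  have gd: "(g has_derivative frechet_derivative g (at (f x))) (at (f x))" if "x \<in> S" for x
    using Ck_on_has_derivative[OF assms(2) Suc.prems(2)] assms(5) that by blast
  show ?case
  proof (rule Ck_on_SucI[OF assms(1)])
    fix x assume x: "x \<in> S"
    show "((\<lambda>x. g (f x)) has_derivative (\<lambda>v. \<Sum>b\<in>Basis.
        (frechet_derivative f (at x) v \<bullet> b) *\<^sub>R frechet_derivative g (at (f x)) b)) (at x)"
      by (rule has_derivative_eq_rhs[OF has_derivative_compose[OF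
              Ck_on_has_derivative[OF assms(1) Suc.prems(1) x] gd[OF x]]])
        (rule ext, rule linear_eq_sum_Basis[OF has_derivative_linear[OF gd[OF x]]])
  next
    fix v
    have "Ck_on k (\<lambda>x. frechet_derivative g (at (f x)) b) S" for b
      by (rule Suc.IH[of "\<lambda>y. frechet_derivative g (at y) b"]) (use Suc.prems Ck_on_Suc_imp in auto)
    then show "Ck_on k (\<lambda>x. \<Sum>b\<in>Basis. (frechet_derivative f (at x) v \<bullet> b) *\<^sub>R
        frechet_derivative g (at (f x)) b) S"
      by (intro Ck_on_sum Ck_on_scaleR Ck_on_inner assms(1) Ck_on_const) (use Suc.prems in auto)
  qed
qed

lemma frechet_derivative_bounded_linear:
  assumes "bounded_linear L" "f differentiable at x"
  shows "frechet_derivative (\<lambda>y. L (f y)) (at x) v = L (frechet_derivative f (at x) v)"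
  using bounded_linear.has_derivative[OF assms(1)] assms(2) frechet_derivative_at frechet_derivative_works
  by metis

section \<open>Symmetry of second derivatives\<close>

text \<open>The mean value theorem is applied twice, first along \<open>u\<close> and then along
  \<open>v\<close>. The second difference is symmetric in \<open>u\<close> and \<open>v\<close>,
  whereas the right-hand side shows only one order of differentiation.\<close>

lemma second_difference_mvt:
  fixes f :: "'e::euclidean_space \<Rightarrow> real"
  assumes S: "open S" "Ck_on 2 f S" and h: "h > 0"
    and box: "\<And>s t. 0 \<le> s \<Longrightarrow> s \<le> h \<Longrightarrow> 0 \<le> t \<Longrightarrow> t \<le> h \<Longrightarrow> x + s *\<^sub>R u + t *\<^sub>R v \<in> S"
  shows "\<exists>s t. 0 < s \<and> s < h \<and> 0 < t \<and> t < h \<and>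
    f (x + h *\<^sub>R u + h *\<^sub>R v) - f (x + h *\<^sub>R u) - f (x + h *\<^sub>R v) + f x
      = h * h * frechet_derivative (\<lambda>y. frechet_derivative f (at y) u) (at (x + s *\<^sub>R u + t *\<^sub>R v)) v"
proof -
  have S2: "Ck_on (Suc (Suc 0)) f S" using S by (simp only: numeral_2_eq_2)
  let ?F = "\<lambda>y. frechet_derivative f (at y) u"
  have fd: "(f has_derivative frechet_derivative f (at y)) (at y)" if "y \<in> S" for y
    using Ck_on_has_derivative[OF S(1) S2 that] .
  have Fd: "(?F has_derivative frechet_derivative ?F (at y)) (at y)" if "y \<in> S" for y
    using Ck_on_has_derivative[OF S(1) _ that, of 0 ?F] S2 by simp
  have d1: "((\<lambda>s. f (x + s *\<^sub>R u + t *\<^sub>R v)) has_real_derivative ?F (x + s *\<^sub>R u + t *\<^sub>R v)) (at s)"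
    if "0 \<le> s" "s \<le> h" "0 \<le> t" "t \<le> h" for s t
  proof -
    have "((\<lambda>s. f (x + s *\<^sub>R u + t *\<^sub>R v)) has_derivative
       (\<lambda>r. frechet_derivative f (at (x + s *\<^sub>R u + t *\<^sub>R v)) (r *\<^sub>R u))) (at s)"
      by (rule has_derivative_compose[where f="\<lambda>s. x + s *\<^sub>R u + t *\<^sub>R v", OF _ fd[OF box[OF that]]]) (auto intro!: derivative_eq_intros)
    moreover have "linear (frechet_derivative f (at (x + s *\<^sub>R u + t *\<^sub>R v)))"
      using fd[OF box[OF that]] has_derivative_linear by blast
    ultimately show ?thesis
      by (simp add: has_field_derivative_def linear_scale mult.commute[of "?F _"] mult_commute_abs)
  qed
  have d2: "((\<lambda>t. ?F (x + s *\<^sub>R u + t *\<^sub>R v)) has_real_derivative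
      frechet_derivative ?F (at (x + s *\<^sub>R u + t *\<^sub>R v)) v) (at t)"
    if "0 \<le> s" "s \<le> h" "0 \<le> t" "t \<le> h" for s t
  proof -
    have "((\<lambda>t. ?F (x + s *\<^sub>R u + t *\<^sub>R v)) has_derivative
       (\<lambda>r. frechet_derivative ?F (at (x + s *\<^sub>R u + t *\<^sub>R v)) (r *\<^sub>R v))) (at t)"
      by (rule has_derivative_compose[where f="\<lambda>t. x + s *\<^sub>R u + t *\<^sub>R v", OF _ Fd[OF box[OF that]]]) (auto intro!: derivative_eq_intros)
    moreover have "linear (frechet_derivative ?F (at (x + s *\<^sub>R u + t *\<^sub>R v)))"
      using Fd[OF box[OF that]] has_derivative_linear by blast
    ultimately show ?thesis
      by (simp add: has_field_derivative_def linear_scale mult_commute_abs)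
  qed
  \<comment> \<open>The summand \<open>0 *\<^sub>R v\<close> is kept so that \<open>d1\<close>
    matches literally with \<open>t = 0\<close>.\<close>
  define a where "a = (\<lambda>s. f (x + s *\<^sub>R u + h *\<^sub>R v) - f (x + s *\<^sub>R u + 0 *\<^sub>R v))"
  have "\<exists>s>0. s < h \<and> a h - a 0 = (h - 0) * (?F (x + s *\<^sub>R u + h *\<^sub>R v) - ?F (x + s *\<^sub>R u + 0 *\<^sub>R v))"
    by (rule MVT2[OF h]) (unfold a_def, intro DERIV_diff d1, use h in auto)
  then obtain s where s: "0 < s" "s < h"
    "a h - a 0 = h * (?F (x + s *\<^sub>R u + h *\<^sub>R v) - ?F (x + s *\<^sub>R u + 0 *\<^sub>R v))" by auto
  have "\<exists>t>0. t < h \<and> ?F (x + s *\<^sub>R u + h *\<^sub>R v) - ?F (x + s *\<^sub>R u + 0 *\<^sub>R v)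
      = (h - 0) * frechet_derivative ?F (at (x + s *\<^sub>R u + t *\<^sub>R v)) v"
    by (rule MVT2[OF h]) (intro d2, use s in auto)
  then obtain t where t: "0 < t" "t < h" "?F (x + s *\<^sub>R u + h *\<^sub>R v) - ?F (x + s *\<^sub>R u + 0 *\<^sub>R v)
      = h * frechet_derivative ?F (at (x + s *\<^sub>R u + t *\<^sub>R v)) v" by auto
  show ?thesis
    using s t by (intro exI[of _ s] exI[of _ t]) (simp add: a_def algebra_simps)
qed

text \<open>One and the same second difference equals \<open>h * h\<close> times either mixed
  derivative, each at a point close to \<open>x\<close>; continuity of both mixed derivatives then
  excludes a gap between them at \<open>x\<close>.\<close>

lemma symmetric_second_derivative_real:
  fixes f :: "'e::euclidean_space \<Rightarrow> real"
  assumes S: "open S" "Ck_on 2 f S" and x: "x \<in> S"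
  shows "frechet_derivative (\<lambda>y. frechet_derivative f (at y) u) (at x) v
       = frechet_derivative (\<lambda>y. frechet_derivative f (at y) v) (at x) u"
proof -
  define A where "A y = frechet_derivative (\<lambda>y. frechet_derivative f (at y) u) (at y) v" for y
  define B where "B y = frechet_derivative (\<lambda>y. frechet_derivative f (at y) v) (at y) u" for y
  have S2: "Ck_on (Suc (Suc 0)) f S" using S by (simp only: numeral_2_eq_2)
  have cont: "isCont A x" "isCont B x"
    using S2 S(1) x unfolding A_def[abs_def] B_def[abs_def] by (auto simp: continuous_on_eq_continuous_at)
  obtain r where r: "r > 0" "ball x r \<subseteq> S" using S(1) x open_contains_ball by blast
  define N where "N = norm u + norm v + 1"
  have N: "N > 0" unfolding N_def by (simp add: add_nonneg_pos)
  have dist: "dist (x + s *\<^sub>R u + t *\<^sub>R v) x \<le> h * (N - 1)" if "0 \<le> s" "s \<le> h" "0 \<le> t" "t \<le> h" for s t h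
  proof -
    have "dist (x + s *\<^sub>R u + t *\<^sub>R v) x = norm (s *\<^sub>R u + t *\<^sub>R v)" by (simp add: dist_norm algebra_simps)
    also have "\<dots> \<le> s * norm u + t * norm v" using norm_triangle_ineq[of "s *\<^sub>R u" "t *\<^sub>R v"] that by simp
    also have "\<dots> \<le> h * norm u + h * norm v" using that by (intro add_mono mult_right_mono) auto
    finally show ?thesis by (simp add: N_def algebra_simps)
  qed
  have "A x = B x"
  proof (rule ccontr)
    assume "A x \<noteq> B x"
    \<comment> \<open>Half the gap: values within \<open>e\<close> of \<open>A x\<close> and of
      \<open>B x\<close> cannot coincide.\<close>
    define e where "e = \<bar>A x - B x\<bar> / 2"
    have e: "e > 0" using \<open>A x \<noteq> B x\<close> by (simp add: e_def)
    obtain d1 where d1: "d1 > 0" "\<And>y. dist y x < d1 \<Longrightarrow> dist (A y) (A x) < e"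
      using cont(1) e unfolding continuous_at_eps_delta by metis
    obtain d2 where d2: "d2 > 0" "\<And>y. dist y x < d2 \<Longrightarrow> dist (B y) (B x) < e"
      using cont(2) e unfolding continuous_at_eps_delta by metis
    \<comment> \<open>Small enough for the whole parallelogram to lie in all three balls. The
      summand 1 in \<open>N\<close> covers \<open>u = v = 0\<close> and makes the distance bound
      \<open>h * (N - 1)\<close> strictly smaller than the radii.\<close>
    define h where "h = min r (min d1 d2) / N"
    have h: "h > 0" "h * N \<le> r" "h * N \<le> d1" "h * N \<le> d2"
      using r d1 d2 N by (auto simp: h_def)
    have hN: "h * (N - 1) < h * N" using h(1) by simp
    have box: "x + s *\<^sub>R u + t *\<^sub>R v \<in> S" "x + s *\<^sub>R v + t *\<^sub>R u \<in> S" if "0 \<le> s" "s \<le> h" "0 \<le> t" "t \<le> h" for s t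
    proof -
      have c: "x + s *\<^sub>R v + t *\<^sub>R u = x + t *\<^sub>R u + s *\<^sub>R v" by simp
      have "dist (x + s *\<^sub>R u + t *\<^sub>R v) x < r" "dist (x + t *\<^sub>R u + s *\<^sub>R v) x < r"
        using dist[OF that] dist[OF that(3,4,1,2)] hN h(2) by linarith+
      then show "x + s *\<^sub>R u + t *\<^sub>R v \<in> S" "x + s *\<^sub>R v + t *\<^sub>R u \<in> S"
        using r(2) unfolding c by (auto simp: dist_commute)
    qed
    obtain s t where st: "0 < s" "s < h" "0 < t" "t < h"
      "f (x + h *\<^sub>R u + h *\<^sub>R v) - f (x + h *\<^sub>R u) - f (x + h *\<^sub>R v) + f x = h * h * A (x + s *\<^sub>R u + t *\<^sub>R v)"
      using second_difference_mvt[of S f h x u v, folded A_def] S h(1) box(1) by blast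
    obtain s' t' where st': "0 < s'" "s' < h" "0 < t'" "t' < h"
      "f (x + h *\<^sub>R v + h *\<^sub>R u) - f (x + h *\<^sub>R v) - f (x + h *\<^sub>R u) + f x = h * h * B (x + s' *\<^sub>R v + t' *\<^sub>R u)"
      using second_difference_mvt[of S f h x v u, folded B_def] S h(1) box(2) by blast
    have swap: "x + h *\<^sub>R v + h *\<^sub>R u = x + h *\<^sub>R u + h *\<^sub>R v" by simp
    have "h * h * A (x + s *\<^sub>R u + t *\<^sub>R v) = h * h * B (x + s' *\<^sub>R v + t' *\<^sub>R u)"
      using st(5) st'(5)[unfolded swap] by linarith
    then have AB: "A (x + s *\<^sub>R u + t *\<^sub>R v) = B (x + t' *\<^sub>R u + s' *\<^sub>R v)"
      using h(1) by (simp add: add.assoc add.commute[of "t' *\<^sub>R u"])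
    have "dist (A (x + s *\<^sub>R u + t *\<^sub>R v)) (A x) < e"
      by (rule d1(2)) (use dist[of s h t] st hN h in linarith)
    moreover have "dist (B (x + t' *\<^sub>R u + s' *\<^sub>R v)) (B x) < e"
      by (rule d2(2)) (use dist[of t' h s'] st' hN h in linarith)
    ultimately show False using AB by (auto simp: e_def dist_real_def abs_if split: if_splits)
  qed
  then show ?thesis by (simp add: A_def B_def)
qed

lemma symmetric_second_derivative:
  fixes f :: "'e::euclidean_space \<Rightarrow> 'f::euclidean_space"
  assumes S: "open S" "Ck_on 2 f S" and x: "x \<in> S"
  shows "frechet_derivative (\<lambda>y. frechet_derivative f (at y) u) (at x) v
       = frechet_derivative (\<lambda>y. frechet_derivative f (at y) v) (at x) u"
proof (rule euclidean_eqI)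
  fix b :: 'f assume "b \<in> Basis"
  have S2: "Ck_on (Suc (Suc 0)) f S" using S by (simp only: numeral_2_eq_2)
  have comp: "frechet_derivative (\<lambda>y. frechet_derivative (\<lambda>y. f y \<bullet> b) (at y) w) (at x) z
     = frechet_derivative (\<lambda>y. frechet_derivative f (at y) w) (at x) z \<bullet> b" for w z
  proof -
    have D: "(\<lambda>y. frechet_derivative f (at y) w) differentiable at x"
      using Ck_on_differentiable[OF S(1) _ x, of 0 "\<lambda>y. frechet_derivative f (at y) w"] S2 by simp
    have eq: "frechet_derivative (\<lambda>y. f y \<bullet> b) (at y) w = frechet_derivative f (at y) w \<bullet> b" if "y \<in> S" for y
      by (rule frechet_derivative_bounded_linear[OF bounded_linear_inner_left Ck_on_differentiable[OF S(1) S2 that]])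
    have D': "(\<lambda>y. frechet_derivative f (at y) w \<bullet> b) differentiable at x"
      using D by (auto intro!: derivative_intros)
    have "frechet_derivative (\<lambda>y. frechet_derivative (\<lambda>y. f y \<bullet> b) (at y) w) (at x)
       = frechet_derivative (\<lambda>y. frechet_derivative f (at y) w \<bullet> b) (at x)"
      by (rule frechet_derivative_transform_within_open[OF D' S(1) x, symmetric]) (simp add: eq)
    then show ?thesis
      by (simp add: frechet_derivative_bounded_linear[OF bounded_linear_inner_left D])
  qed
  have "Ck_on 2 (\<lambda>y. f y \<bullet> b) S" by (intro Ck_on_inner S Ck_on_const)
  from symmetric_second_derivative_real[OF S(1) this x]
  show "frechet_derivative (\<lambda>y. frechet_derivative f (at y) u) (at x) v \<bullet> b
      = frechet_derivative (\<lambda>y. frechet_derivative f (at y) v) (at x) u \<bullet> b"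
    by (simp only: comp)
qed

section \<open>Families of linear and bilinear maps with moving arguments\<close>

text \<open>Tensors in a chart are known to be smooth for constant arguments only; basis expansion
  extends this to arguments that vary with the point.\<close>

lemma Ck_on_linear_family:
  fixes A :: "'e::euclidean_space \<Rightarrow> 'f::euclidean_space"
  assumes S: "open S" and lin: "\<And>y. y \<in> S \<Longrightarrow> linear (L y)"
    and L: "\<And>u. Ck_on k (\<lambda>y. L y u) S" and A: "Ck_on k A S"
  shows "Ck_on k (\<lambda>y. L y (A y)) S"
proof (rule Ck_on_cong[OF S])
  show "Ck_on k (\<lambda>y. \<Sum>b\<in>Basis. (A y \<bullet> b) *\<^sub>R L y b) S"
    by (intro Ck_on_sum Ck_on_scaleR Ck_on_inner S L A Ck_on_const)
qed (metis lin linear_eq_sum_Basis)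

lemma Ck_on_bilinear_family:
  fixes A :: "'e::euclidean_space \<Rightarrow> 'f::euclidean_space" and V :: "'e \<Rightarrow> 'g::euclidean_space"
  assumes S: "open S" and bil: "\<And>y. y \<in> S \<Longrightarrow> bilinear (Q y)"
    and Q: "\<And>u v. Ck_on k (\<lambda>y. Q y u v) S" and A: "Ck_on k A S" and V: "Ck_on k V S"
  shows "Ck_on k (\<lambda>y. Q y (A y) (V y)) S"
proof -
  have lin: "linear (\<lambda>u. Q y u v)" "linear (Q y u)" if "y \<in> S" for y u v
    using bil[OF that] by (auto simp: bilinear_def)
  have "Ck_on k (\<lambda>y. Q y (A y) v) S" for v
    by (rule Ck_on_linear_family[where L = "\<lambda>y u. Q y u v", OF S lin(1) Q A])
  from Ck_on_linear_family[where L = "\<lambda>y. Q y (A y)", OF S lin(2) this V]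
  show ?thesis .
qed

text \<open>The Leibniz rule for applying a varying linear map to a varying vector, obtained by
  differentiating the basis expansion.\<close>

lemma has_derivative_linear_family:
  fixes A :: "'e::euclidean_space \<Rightarrow> 'f::euclidean_space"
  assumes S: "open S" "x \<in> S" and lin: "\<And>y. y \<in> S \<Longrightarrow> linear (L y)"
    and L: "\<And>u. ((\<lambda>y. L y u) has_derivative L' u) (at x)" and A: "(A has_derivative A') (at x)"
  shows "((\<lambda>y. L y (A y)) has_derivative (\<lambda>w. L' (A x) w + L x (A' w))) (at x)"
proof -
  have expand: "(\<Sum>b\<in>Basis. (u \<bullet> b) *\<^sub>R L y b) = L y u" if "y \<in> S" for y u
    by (rule linear_eq_sum_Basis[OF lin[OF that], symmetric])
  have "((\<lambda>y. \<Sum>b\<in>Basis. (A x \<bullet> b) *\<^sub>R L y b) has_derivative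
      (\<lambda>w. \<Sum>b\<in>Basis. (A x \<bullet> b) *\<^sub>R L' b w)) (at x)"
    by (intro has_derivative_sum has_derivative_scaleR_right L)
  then have "((\<lambda>y. L y (A x)) has_derivative (\<lambda>w. \<Sum>b\<in>Basis. (A x \<bullet> b) *\<^sub>R L' b w)) (at x)"
    by (rule has_derivative_transform_within_open[OF _ S expand])
  \<comment> \<open>\<open>L'\<close> is given separately for each argument; uniqueness of the
    derivative shows that its value at \<open>A x\<close> has the expected expansion.\<close>
  then have L'A: "L' (A x) = (\<lambda>w. \<Sum>b\<in>Basis. (A x \<bullet> b) *\<^sub>R L' b w)"
    using L has_derivative_unique by blast
  have "((\<lambda>y. \<Sum>b\<in>Basis. (A y \<bullet> b) *\<^sub>R L y b) has_derivative
      (\<lambda>w. \<Sum>b\<in>Basis. (A x \<bullet> b) *\<^sub>R L' b w + (A' w \<bullet> b) *\<^sub>R L x b)) (at x)"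
    by (intro has_derivative_sum has_derivative_scaleR has_derivative_inner_left A L)
  then have "((\<lambda>y. L y (A y)) has_derivative
      (\<lambda>w. \<Sum>b\<in>Basis. (A x \<bullet> b) *\<^sub>R L' b w + (A' w \<bullet> b) *\<^sub>R L x b)) (at x)"
    by (rule has_derivative_transform_within_open[OF _ S expand])
  then show ?thesis by (simp add: L'A sum.distrib expand S)
qed

lemma has_derivative_bilinear_family:
  fixes A :: "'e::euclidean_space \<Rightarrow> 'f::euclidean_space" and V :: "'e \<Rightarrow> 'g::euclidean_space"
  assumes S: "open S" "x \<in> S" and bil: "\<And>y. y \<in> S \<Longrightarrow> bilinear (Q y)"
    and Q: "\<And>u v. ((\<lambda>y. Q y u v) has_derivative Q' u v) (at x)"
    and A: "(A has_derivative A') (at x)" and V: "(V has_derivative V') (at x)"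
  shows "((\<lambda>y. Q y (A y) (V y)) has_derivative
    (\<lambda>w. Q' (A x) (V x) w + Q x (A' w) (V x) + Q x (A x) (V' w))) (at x)"
proof -
  have lin: "linear (\<lambda>u. Q y u v)" "linear (Q y u)" if "y \<in> S" for y u v
    using bil[OF that] by (auto simp: bilinear_def)
  have "((\<lambda>y. Q y (A y) v) has_derivative (\<lambda>w. Q' (A x) v w + Q x (A' w) v)) (at x)" for v
    by (rule has_derivative_linear_family[where L = "\<lambda>y u. Q y u v" and L' = "\<lambda>u. Q' u v", OF S lin(1) Q A])
  from has_derivative_linear_family[where L = "\<lambda>y. Q y (A y)", OF S lin(2) this V]
  show ?thesis .
qed

section \<open>Inner products and orthonormal frames\<close>

text \<open>The inner product of the coordinate type depends on the chart and has no geometric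
  meaning; the locale covers the inner products given by the metric at a point.\<close>

locale inner_form =
  fixes g :: "'e::euclidean_space \<Rightarrow> 'e \<Rightarrow> real"
  assumes bil: "bilinear g" and sym: "g u v = g v u" and pos: "u \<noteq> 0 \<Longrightarrow> g u u > 0"
begin

lemmas simps = bilinear_ladd[OF bil] bilinear_radd[OF bil] bilinear_lsub[OF bil] bilinear_rsub[OF bil]
  bilinear_lmul[OF bil] bilinear_rmul[OF bil] bilinear_lzero[OF bil] bilinear_rzero[OF bil]
  bilinear_lneg[OF bil] bilinear_rneg[OF bil]

lemma linear_left: "linear (\<lambda>u. g u v)" and linear_right: "linear (g u)"
  using bil by (auto simp: bilinear_def)

lemma sum_left: "g (\<Sum>i\<in>I. f i) v = (\<Sum>i\<in>I. g (f i) v)"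
  using linear_sum[OF linear_left] .

lemma sum_right: "g u (\<Sum>i\<in>I. f i) = (\<Sum>i\<in>I. g u (f i))"
  using linear_sum[OF linear_right] .

lemma eq_0_iff: "g u u = 0 \<longleftrightarrow> u = 0"
  using pos[of u] simps by force

lemma nonneg: "g u u \<ge> 0"
  using pos[of u] simps by force

lemma subspace_orth: "subspace (orth g S)"
  unfolding orth_def subspace_def by (auto simp: simps)

lemma orthonormal_expansion:
  assumes E: "orthonormal_basis g S E" and u: "u \<in> S"
  shows "u = (\<Sum>e\<in>E. g u e *\<^sub>R e)"
proof -
  have fin: "finite E" and on: "\<And>a b. a \<in> E \<Longrightarrow> b \<in> E \<Longrightarrow> g a b = (if a = b then 1 else 0)"
    using E by (auto simp: orthonormal_basis_def)
  obtain r where r: "u = (\<Sum>e\<in>E. r e *\<^sub>R e)"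
    using E u fin by (auto simp: orthonormal_basis_def span_finite)
  have "g u e = r e" if e: "e \<in> E" for e
  proof -
    have "g u e = (\<Sum>a\<in>E. r a * g a e)" by (simp add: r sum_left simps)
    also have "\<dots> = (\<Sum>a\<in>E. if a = e then r a else 0)"
      by (rule sum.cong) (auto simp: on e)
    finally show ?thesis using e fin by simp
  qed
  then show ?thesis using r by simp
qed

text \<open>Expanding each vector of \<open>E\<close> in \<open>E'\<close> and summing over
  \<open>E\<close>, the coefficients collapse by the Parseval identity \<open>gram\<close> to
  \<open>g a b\<close>, which is 1 or 0. This makes the choice by \<open>SOME\<close> in
  \<open>trace_on\<close> harmless.\<close>

lemma orthonormal_sum_eq:
  fixes B :: "'e \<Rightarrow> 'e \<Rightarrow> 'v::euclidean_space"
  assumes E: "orthonormal_basis g S E" and E': "orthonormal_basis g S E'" and B: "bilinear B"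
  shows "(\<Sum>e\<in>E. B e e) = (\<Sum>e\<in>E'. B e e)"
proof -
  have fin: "finite E" "finite E'" and ES: "\<And>e. e \<in> E \<Longrightarrow> e \<in> S" "\<And>e. e \<in> E' \<Longrightarrow> e \<in> S"
    using E E' by (auto simp: orthonormal_basis_def intro: span_base)
  have lin: "linear (\<lambda>u. B u v)" "linear (B u)" for u v using B by (auto simp: bilinear_def)
  have on': "\<And>a b. a \<in> E' \<Longrightarrow> b \<in> E' \<Longrightarrow> g a b = (if a = b then 1 else 0)"
    using E' by (auto simp: orthonormal_basis_def)
  have gram: "(\<Sum>e\<in>E. g e a * g e b) = g a b" if "a \<in> E'" for a b
  proof -
    have "g a b = g (\<Sum>e\<in>E. g a e *\<^sub>R e) b" using orthonormal_expansion[OF E ES(2)[OF that]] by simp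
    then show ?thesis by (simp add: sum_left simps sym[of a])
  qed
  have "(\<Sum>e\<in>E. B e e) = (\<Sum>e\<in>E. \<Sum>a\<in>E'. \<Sum>b\<in>E'. (g e a * g e b) *\<^sub>R B a b)"
  proof (rule sum.cong)
    fix e assume "e \<in> E"
    then have e: "e = (\<Sum>a\<in>E'. g e a *\<^sub>R a)" using orthonormal_expansion[OF E'] ES by blast
    have "B e e = (\<Sum>a\<in>E'. g e a *\<^sub>R B a e)"
      by (subst (1) e) (simp only: linear_sum[OF lin(1)] linear_scale[OF lin(1)])
    also have "\<dots> = (\<Sum>a\<in>E'. g e a *\<^sub>R (\<Sum>b\<in>E'. g e b *\<^sub>R B a b))"
    proof (rule sum.cong)
      fix a
      have "B a e = (\<Sum>b\<in>E'. g e b *\<^sub>R B a b)"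
        by (subst (1) e) (simp only: linear_sum[OF lin(2)] linear_scale[OF lin(2)])
      then show "g e a *\<^sub>R B a e = g e a *\<^sub>R (\<Sum>b\<in>E'. g e b *\<^sub>R B a b)" by simp
    qed simp
    finally show "B e e = (\<Sum>a\<in>E'. \<Sum>b\<in>E'. (g e a * g e b) *\<^sub>R B a b)"
      by (simp add: scaleR_sum_right)
  qed simp
  also have "\<dots> = (\<Sum>a\<in>E'. \<Sum>e\<in>E. \<Sum>b\<in>E'. (g e a * g e b) *\<^sub>R B a b)"
    by (rule sum.swap)
  also have "\<dots> = (\<Sum>a\<in>E'. \<Sum>b\<in>E'. \<Sum>e\<in>E. (g e a * g e b) *\<^sub>R B a b)"
    by (rule sum.cong[OF refl], rule sum.swap)
  also have "\<dots> = (\<Sum>a\<in>E'. \<Sum>b\<in>E'. g a b *\<^sub>R B a b)"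
    by (intro sum.cong refl) (simp add: gram flip: scaleR_sum_left)
  also have "\<dots> = (\<Sum>a\<in>E'. \<Sum>b\<in>E'. if b = a then B a b else 0)"
    by (intro sum.cong refl) (auto simp: on')
  finally show ?thesis using fin by simp
qed

end

section \<open>Gram-Schmidt with parameters\<close>

text \<open>Gram-Schmidt is carried out at all points of \<open>S\<close> at once, starting from
  constant vectors. The span of the vectors already treated is the fixed space
  \<open>span A\<close>, so the next remainder \<open>w\<close> vanishes nowhere and can be
  normalised without loss of regularity.\<close>

lemma smooth_orthonormal_frame:
  fixes g :: "'x::euclidean_space \<Rightarrow> 'e::euclidean_space \<Rightarrow> 'e \<Rightarrow> real"
  assumes S: "open S" and g: "\<And>y. y \<in> S \<Longrightarrow> inner_form (g y)"
    and smooth: "\<And>u v. Ck_on k (\<lambda>y. g y u v) S"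
    and "finite A" "independent A"
  shows "\<exists>E. (\<forall>a\<in>A. Ck_on k (E a) S) \<and> (\<forall>y\<in>S.
      (\<forall>a\<in>A. \<forall>b\<in>A. g y (E a y) (E b y) = (if a = b then 1 else 0))
      \<and> span ((\<lambda>a. E a y) ` A) = span A)"
  using assms(4,5)
proof (induction A)
  case empty
  then show ?case by simp
next
  case (insert a A)
  then have indep: "independent A" "a \<notin> span A" by (simp_all add: independent_insert)
  from insert.IH[OF indep(1)] obtain E where E: "\<And>b. b \<in> A \<Longrightarrow> Ck_on k (E b) S"
    "\<And>y b c. y \<in> S \<Longrightarrow> b \<in> A \<Longrightarrow> c \<in> A \<Longrightarrow> g y (E b y) (E c y) = (if b = c then 1 else 0)"
    "\<And>y. y \<in> S \<Longrightarrow> span ((\<lambda>a. E a y) ` A) = span A"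
    by blast
  have bil: "bilinear (g y)" if "y \<in> S" for y using g[OF that] by (rule inner_form.bil)
  \<comment> \<open>The \<open>g y\<close>-orthogonal projection of the new vector to
    \<open>span A\<close>, written in the frame already built.\<close>
  define p where "p y = (\<Sum>b\<in>A. g y a (E b y) *\<^sub>R E b y)" for y
  define w where "w y = a - p y" for y
  have p_span: "p y \<in> span A" if "y \<in> S" for y
    unfolding p_def E(3)[OF that, symmetric] by (intro span_sum span_scale span_base) auto
  then have w0: "w y \<noteq> 0" if "y \<in> S" for y
    using that indep(2) by (auto simp: w_def)
  have Ck_p: "Ck_on k p S" unfolding p_def
    by (intro Ck_on_sum Ck_on_scaleR Ck_on_bilinear_family[OF S bil smooth] S Ck_on_const E)
  have Ck_w: "Ck_on k w S" unfolding w_def by (intro Ck_on_diff S Ck_on_const Ck_p)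
  have orth: "g y (w y) (E b y) = 0" if y: "y \<in> S" and b: "b \<in> A" for y b
  proof -
    interpret inner_form "g y" by (rule g[OF y])
    have "g y (p y) (E b y) = (\<Sum>c\<in>A. g y a (E c y) * g y (E c y) (E b y))"
      by (simp add: p_def sum_left simps)
    also have "\<dots> = (\<Sum>c\<in>A. if c = b then g y a (E c y) else 0)"
      by (rule sum.cong) (auto simp: E y b)
    finally show ?thesis using b insert.hyps by (simp add: w_def simps)
  qed
  define n where "n y = 1 / sqrt (g y (w y) (w y))" for y
  have wpos: "g y (w y) (w y) > 0" if "y \<in> S" for y
    using inner_form.pos[OF g[OF that] w0[OF that]] .
  have Ck_n: "Ck_on k n S" unfolding n_def
    by (intro Ck_on_inverse_sqrt S Ck_on_bilinear_family[OF S bil smooth] Ck_w wpos)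
  have npos: "n y > 0" and nn: "n y * n y * g y (w y) (w y) = 1" if "y \<in> S" for y
    using wpos[OF that] by (auto simp: n_def)
  define E' where "E' = E(a := \<lambda>y. n y *\<^sub>R w y)"
  have E'a: "E' a = (\<lambda>y. n y *\<^sub>R w y)" and E'b: "\<And>b. b \<in> A \<Longrightarrow> E' b = E b"
    using insert.hyps by (auto simp: E'_def)
  have "Ck_on k (E' b) S" if "b \<in> insert a A" for b
    using that E(1) Ck_on_scaleR[OF S Ck_n Ck_w] by (auto simp: E'a E'b)
  moreover have "g y (E' b y) (E' c y) = (if b = c then 1 else 0)"
    if y: "y \<in> S" and "b \<in> insert a A" "c \<in> insert a A" for y b c
  proof -
    interpret inner_form "g y" by (rule g[OF y])
    have "g y (E c y) (w y) = 0" if "c \<in> A" for c using orth[OF y that] sym by simp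
    then show ?thesis using that insert.hyps nn[OF y] orth[OF y]
      by (auto simp: E'a E'b E simps mult.assoc)
  qed
  moreover have "span ((\<lambda>b. E' b y) ` insert a A) = span (insert a A)" if y: "y \<in> S" for y
  proof -
    have img: "(\<lambda>b. E' b y) ` insert a A = insert (n y *\<^sub>R w y) ((\<lambda>b. E b y) ` A)" (is "_ = ?R")
      by (simp add: E'a E'b)
    have A_R: "span A \<subseteq> span ?R" unfolding E(3)[OF y, symmetric] by (rule span_mono) auto
    have A_aA: "span A \<subseteq> span (insert a A)" by (rule span_mono) auto
    have "w y \<in> span ?R"
      using span_scale[OF span_base[of "n y *\<^sub>R w y" ?R], of "1 / n y"] npos[OF y] by simp
    then have "w y + p y \<in> span ?R" using p_span[OF y] A_R by (blast intro: span_add)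
    then have "insert a A \<subseteq> span ?R" using A_R span_superset[of A] by (auto simp: w_def)
    moreover have "w y \<in> span (insert a A)"
      unfolding w_def using p_span[OF y] A_aA by (intro span_diff) (auto intro: span_base)
    then have "?R \<subseteq> span (insert a A)"
      using A_aA E(3)[OF y] span_superset[of "(\<lambda>b. E b y) ` A"] by (auto intro: span_scale)
    ultimately show ?thesis unfolding img by (simp add: span_eq)
  qed
  ultimately show ?case by blast
qed


section \<open>Orthonormal bases, traces and projections\<close>

context inner_form
begin

text \<open>The parametrised Gram-Schmidt process applied to a constant family over the dummy
  parameter space \<open>real\<close> and evaluated at 0.\<close>

lemma orthonormal_basis_exists:
  assumes "subspace S"
  shows "\<exists>E. orthonormal_basis g S E"
proof -
  obtain A where A: "A \<subseteq> S" "independent A" "S \<subseteq> span A" by (rule basis_exists)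
  then have S: "span A = S" using assms span_minimal by blast
  have "finite A" using A independent_imp_finite by blast
  have frame: "\<exists>F::'e \<Rightarrow> real \<Rightarrow> 'e. (\<forall>a\<in>A. Ck_on 0 (F a) UNIV) \<and> (\<forall>y\<in>UNIV.
      (\<forall>a\<in>A. \<forall>b\<in>A. g (F a y) (F b y) = (if a = b then 1 else 0)) \<and> span ((\<lambda>a. F a y) ` A) = span A)"
    by (rule smooth_orthonormal_frame) (simp_all add: inner_form_axioms Ck_on_const \<open>finite A\<close> A)
  then obtain F :: "'e \<Rightarrow> real \<Rightarrow> 'e" where F: "\<And>y a b. a \<in> A \<Longrightarrow> b \<in> A \<Longrightarrow> g (F a y) (F b y) = (if a = b then 1 else 0)"
    "\<And>y. span ((\<lambda>a. F a y) ` A) = span A"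
    by blast
  define E where "E a = F a 0" for a
  have E: "\<And>a b. a \<in> A \<Longrightarrow> b \<in> A \<Longrightarrow> g (E a) (E b) = (if a = b then 1 else 0)" "span (E ` A) = span A"
    using F F(2)[of 0] by (simp_all add: E_def)
  have inj: "inj_on E A" by (rule inj_onI) (metis E(1) zero_neq_one)
  have "orthonormal_basis g S (E ` A)"
    unfolding orthonormal_basis_def using E S \<open>finite A\<close> inj_on_eq_iff[OF inj] by auto
  then show ?thesis by blast
qed

lemma some_orthonormal_basis:
  "subspace S \<Longrightarrow> orthonormal_basis g S (SOME E. orthonormal_basis g S E)"
  using orthonormal_basis_exists someI_ex by metis

lemma trace_on_eq:
  fixes B :: "'e \<Rightarrow> 'e \<Rightarrow> 'v::euclidean_space"
  assumes E: "orthonormal_basis g S E" and "bilinear B"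
  shows "trace_on g S B = (\<Sum>e\<in>E. B e e)"
proof -
  have "orthonormal_basis g S (SOME E. orthonormal_basis g S E)" using E by (rule someI)
  then show ?thesis unfolding trace_on_def using orthonormal_sum_eq assms by blast
qed

lemma trace_on_frame:
  fixes B :: "'e \<Rightarrow> 'e \<Rightarrow> 'v::euclidean_space"
  assumes "finite I" and on: "\<And>i j. i \<in> I \<Longrightarrow> j \<in> I \<Longrightarrow> g (e i) (e j) = (if i = j then 1 else 0)"
    and "span (e ` I) = S" "bilinear B"
  shows "trace_on g S B = (\<Sum>i\<in>I. B (e i) (e i))"
proof -
  have inj: "inj_on e I" by (rule inj_onI) (metis on zero_neq_one)
  have "orthonormal_basis g S (e ` I)"
    unfolding orthonormal_basis_def using assms(1,3) on inj by (auto simp: inj_on_eq_iff)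
  then have "trace_on g S B = (\<Sum>u\<in>e ` I. B u u)" using assms(4) by (rule trace_on_eq)
  then show ?thesis by (simp add: sum.reindex[OF inj])
qed

lemma orthogonal_decomposition:
  assumes "subspace S"
  obtains w where "w \<in> S" "u - w \<in> orth g S"
proof -
  obtain E where E: "orthonormal_basis g S E" using orthonormal_basis_exists[OF assms] ..
  define w where "w = (\<Sum>e\<in>E. g u e *\<^sub>R e)"
  have "E \<subseteq> S" using E by (auto simp: orthonormal_basis_def intro: span_base)
  then have "w \<in> S" unfolding w_def
    by (intro subspace_sum[OF assms] subspace_scale[OF assms]) blast
  moreover have "g (u - w) v = 0" if "v \<in> S" for v
  proof -
    have "g w v = (\<Sum>e\<in>E. g u e * g e v)" by (simp add: w_def sum_left simps)
    also have "\<dots> = g u (\<Sum>e\<in>E. g v e *\<^sub>R e)"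
      by (simp add: sum_right simps sym[of _ v] mult.commute)
    finally show ?thesis using orthonormal_expansion[OF E that] by (simp add: simps)
  qed
  ultimately show ?thesis using that by (auto simp: orth_def)
qed

lemma orth_Int: "u \<in> S \<Longrightarrow> u \<in> orth g S \<Longrightarrow> u = 0"
  using eq_0_iff[of u] by (auto simp: orth_def)

lemma oproj:
  assumes "subspace S"
  shows "oproj g S u \<in> S" "u - oproj g S u \<in> orth g S"
proof -
  obtain w where w: "w \<in> S" "u - w \<in> orth g S" using orthogonal_decomposition[OF assms] .
  have "\<exists>!w. w \<in> S \<and> u - w \<in> orth g S"
  proof (rule ex1I)
    show "w \<in> S \<and> u - w \<in> orth g S" using w by simp
    fix w' assume w': "w' \<in> S \<and> u - w' \<in> orth g S"
    have "w' - w \<in> S" using w w' assms by (simp add: subspace_diff)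
    moreover have "(u - w) - (u - w') \<in> orth g S"
      using w w' subspace_orth by (blast intro: subspace_diff)
    then have "w' - w \<in> orth g S" by simp
    ultimately show "w' = w" using orth_Int by fastforce
  qed
  from theI'[OF this] show "oproj g S u \<in> S" "u - oproj g S u \<in> orth g S"
    by (simp_all add: oproj_def)
qed

lemma orth_orth:
  assumes "subspace S"
  shows "orth g (orth g S) = S"
proof (intro equalityI subsetI)
  fix u assume u: "u \<in> orth g (orth g S)"
  obtain w where w: "w \<in> S" "u - w \<in> orth g S" using orthogonal_decomposition[OF assms] .
  have "g u (u - w) = 0" using u w by (auto simp: orth_def)
  moreover have "g w (u - w) = 0" using w by (auto simp: orth_def sym[of w])
  ultimately have "g (u - w) (u - w) = 0" by (simp only: simps)
  then show "u \<in> S" using w by (simp add: eq_0_iff)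
next
  fix u assume "u \<in> S"
  then show "u \<in> orth g (orth g S)" using sym by (auto simp: orth_def)
qed

text \<open>Orthonormal bases of a subspace and of its orthogonal complement unite to one of the
  whole space. With the kernel for \<open>S\<close>, this splits the tension field into a horizontal
  and a vertical trace.\<close>

lemma trace_on_split:
  fixes B :: "'e \<Rightarrow> 'e \<Rightarrow> 'v::euclidean_space"
  assumes S: "subspace S" and B: "bilinear B"
  shows "trace_on g UNIV B = trace_on g (orth g S) B + trace_on g S B"
proof -
  obtain E where E: "orthonormal_basis g S E" using orthonormal_basis_exists[OF S] ..
  obtain E' where E': "orthonormal_basis g (orth g S) E'"
    using orthonormal_basis_exists[OF subspace_orth] by blast
  have sub: "E \<subseteq> S" "E' \<subseteq> orth g S"
    using E E' by (auto simp: orthonormal_basis_def intro: span_base)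
  have disj: "E' \<inter> E = {}"
  proof -
    have "g e e = 1" if "e \<in> E" for e using E that by (auto simp: orthonormal_basis_def)
    then have "e \<noteq> 0" if "e \<in> E" for e using that eq_0_iff[of e] by force
    then show ?thesis using sub orth_Int by blast
  qed
  have "u \<in> span (E' \<union> E)" for u
  proof -
    obtain w where w: "w \<in> S" "u - w \<in> orth g S" using orthogonal_decomposition[OF S] .
    then have "w \<in> span (E' \<union> E)" "u - w \<in> span (E' \<union> E)"
      using E E' span_mono[of E "E' \<union> E"] span_mono[of E' "E' \<union> E"]
      by (auto simp: orthonormal_basis_def)
    then show ?thesis using span_add by fastforce
  qed
  moreover have "g a b = 0" "g b a = 0" if "a \<in> E'" "b \<in> E" for a b
  proof -
    show "g a b = 0" using sub that by (auto simp: orth_def)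
    then show "g b a = 0" by (simp add: sym[of b])
  qed
  ultimately have "orthonormal_basis g UNIV (E' \<union> E)"
    using E E' disj by (auto simp: orthonormal_basis_def)
  then have "trace_on g UNIV B = (\<Sum>e\<in>E' \<union> E. B e e)" using B by (rule trace_on_eq)
  also have "\<dots> = (\<Sum>e\<in>E'. B e e) + (\<Sum>e\<in>E. B e e)"
    using E E' disj by (intro sum.union_disjoint) (auto simp: orthonormal_basis_def)
  finally show ?thesis using trace_on_eq[OF E B] trace_on_eq[OF E' B] by simp
qed

end

section \<open>Maps in charts\<close>

locale riemannian_chart =
  fixes M :: "('a, 'e::euclidean_space) riem" and c :: "('a, 'e) chart"
  assumes manifold: "riemannian_manifold M" and atlas: "c \<in> atlas M"
begin

lemma chart: "is_chart (topo M) c"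
  using manifold atlas by (auto simp: riemannian_manifold_def smooth_manifold_def)

lemma open_cimg: "open (cimg c)"
  using chart by (simp add: is_chart_def)

lemma inner_form_metric: "x \<in> cimg c \<Longrightarrow> inner_form (metric M c x)"
  using manifold atlas
  by (auto simp: riemannian_manifold_def riemannian_metric_def inner_form_def)

lemma Ck_metric: "Ck_on k (\<lambda>x. metric M c x u v) (cimg c)"
  using manifold atlas
  by (auto simp: riemannian_manifold_def riemannian_metric_def smooth_on_def)

lemma bilinear_conn: "x \<in> cimg c \<Longrightarrow> bilinear (conn M c x)"
  using manifold atlas
  by (auto simp: riemannian_manifold_def levi_civita_def affine_connection_def)

lemma Ck_conn: "Ck_on k (\<lambda>x. conn M c x u v) (cimg c)"
  using manifold atlas
  by (auto simp: riemannian_manifold_def levi_civita_def affine_connection_def smooth_on_def)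

lemma nabla_const: "nabla M c X (\<lambda>_. v) x = conn M c x (X x) v"
  by (simp add: nabla_def)

text \<open>Fields with constant coordinates commute, so vanishing torsion becomes symmetry of the
  Christoffel symbols, and compatibility with the metric becomes a formula for the derivative of the
  metric components.\<close>

lemma levi_civita_const:
  assumes "x \<in> cimg c"
  shows "conn M c x u v = conn M c x v u"
    and "frechet_derivative (\<lambda>y. metric M c y v w) (at x) u
      = metric M c x (conn M c x u v) w + metric M c x v (conn M c x u w)"
proof -
  have const: "smooth_on (\<lambda>_. u :: 'e) (cimg c)" for u
    by (simp add: smooth_on_def Ck_on_const open_cimg)
  have "levi_civita M" using manifold by (simp add: riemannian_manifold_def)
  then have "nabla M c (\<lambda>_. u) (\<lambda>_. v) x - nabla M c (\<lambda>_. v) (\<lambda>_. u) x = lie_bracket (\<lambda>_. u) (\<lambda>_. v) x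
    \<and> frechet_derivative (\<lambda>y. metric M c y v w) (at x) u
      = metric M c x (nabla M c (\<lambda>_. u) (\<lambda>_. v) x) w + metric M c x v (nabla M c (\<lambda>_. u) (\<lambda>_. w) x)"
    unfolding levi_civita_def using atlas const assms by blast
  then show "conn M c x u v = conn M c x v u"
    and "frechet_derivative (\<lambda>y. metric M c y v w) (at x) u
      = metric M c x (conn M c x u v) w + metric M c x v (conn M c x u w)"
    by (simp_all add: nabla_const lie_bracket_def)
qed

lemma metric_has_derivative:
  assumes "x \<in> cimg c"
  shows "((\<lambda>y. metric M c y v w) has_derivative
    (\<lambda>u. metric M c x (conn M c x u v) w + metric M c x v (conn M c x u w))) (at x)"
  using Ck_on_has_derivative[OF open_cimg Ck_metric assms] levi_civita_const(2)[OF assms]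
  by (metis (no_types, lifting) ext)

lemma curv_at_antisym:
  assumes "x \<in> cimg c"
  shows "curv_at M c x u v w = - curv_at M c x v u w"
proof -
  have "lie_bracket (\<lambda>_. u) (\<lambda>_. v) = (\<lambda>_. 0)" for u v :: 'e
    by (rule ext) (simp add: lie_bracket_def)
  then have "curv M c (\<lambda>_. u) (\<lambda>_. v) (\<lambda>_. w) x = nabla M c (\<lambda>_. u) (nabla M c (\<lambda>_. v) (\<lambda>_. w)) x
      - nabla M c (\<lambda>_. v) (nabla M c (\<lambda>_. u) (\<lambda>_. w)) x - conn M c x 0 w" for u v
    by (simp add: curv_def nabla_const)
  moreover have "conn M c x 0 w = 0"
    using bilinear_lzero[OF bilinear_conn[OF assms]] .
  ultimately show ?thesis by (simp add: curv_at_def)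
qed

text \<open>Serves the degenerate case \<open>u = 0\<close> of the curvature formula below. The
  inner covariant derivative vanishes on the open set \<open>cimg c\<close>, so its derivative at
  \<open>x\<close> vanishes too.\<close>

lemma curv_at_zero:
  assumes x: "x \<in> cimg c"
  shows "curv_at M c x u v 0 = 0"
proof -
  have zero: "nabla M c X (\<lambda>_. 0) y = 0" if "y \<in> cimg c" for X y
    using bilinear_rzero[OF bilinear_conn[OF that]] by (simp add: nabla_const)
  have "nabla M c X (nabla M c Y (\<lambda>_. 0)) x = 0" for X Y
  proof -
    have "(nabla M c Y (\<lambda>_. 0) has_derivative (\<lambda>_. 0)) (at x)"
      by (rule has_derivative_transform_within_open[OF has_derivative_const open_cimg x])
        (simp add: zero)
    then have "frechet_derivative (nabla M c Y (\<lambda>_. 0)) (at x) = (\<lambda>_. 0)"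
      by (rule frechet_derivative_at[symmetric])
    then show ?thesis
      using bilinear_rzero[OF bilinear_conn[OF x]] by (simp add: nabla_def[of M c X] zero[OF x])
  qed
  then show ?thesis by (simp add: curv_at_def curv_def zero[OF x])
qed

end

text \<open>For orthogonal \<open>u\<close>, \<open>v\<close> the denominator of the sectional
  curvature is the product of the squared norms; exchanging the first two arguments of the curvature
  gives the minus sign. Zero vectors are treated apart, as \<open>space_form\<close> speaks of
  independent pairs only.\<close>

lemma space_form_curvature:
  assumes N: "space_form N k" and d: "d \<in> atlas N" and x: "x \<in> cimg d"
    and orth: "metric N d x u v = 0"
  shows "metric N d x (curv_at N d x u v u) v = - k * metric N d x u u * metric N d x v v"
proof -
  interpret riemannian_chart N d using N d by unfold_locales (simp_all add: space_form_def)
  interpret inner_form "metric N d x" using x by (rule inner_form_metric)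
  show ?thesis
  proof (cases "u = 0 \<or> v = 0")
    case True
    then show ?thesis using curv_at_zero[OF x] by (auto simp: simps)
  next
    case False
    then have nz: "metric N d x u u \<noteq> 0" "metric N d x v v \<noteq> 0" by (simp_all add: eq_0_iff)
    have "v \<notin> span {u}"
    proof
      assume "v \<in> span {u}"
      then obtain r where "v = r *\<^sub>R u" by (auto simp: span_singleton)
      then show False using orth nz False by (simp add: simps)
    qed
    then have "v \<noteq> u \<and> independent {v, u}"
      using False by (auto simp: independent_insert span_base)
    then have "sectional_curvature N d x v u = k"
      using N d x by (auto simp: space_form_def)
    then have "metric N d x (curv_at N d x v u u) v = k * metric N d x u u * metric N d x v v"
      using nz orth sym[of v u] by (simp add: sectional_curvature_def field_simps)
    then show ?thesis by (simp add: curv_at_antisym[OF x, of u v] simps)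
  qed
qed

section \<open>A Riemannian map in a pair of charts\<close>

locale riemannian_map_charts =
  src: riemannian_chart M c + tgt: riemannian_chart N d
  for M :: "('a, 'e::euclidean_space) riem" and c :: "('a, 'e) chart"
    and N :: "('b, 'f::euclidean_space) riem" and d :: "('b, 'f) chart" +
  fixes F :: "'a \<Rightarrow> 'b"
  assumes rmap: "riemannian_map M N F"
begin

abbreviation "S \<equiv> ldom c d F"
abbreviation "f \<equiv> loc c d F"
abbreviation "Df \<equiv> tmap c d F"
abbreviation "g \<equiv> metric M c"
abbreviation "h y \<equiv> metric N d (f y)"
abbreviation "K \<equiv> ker_at c d F"
abbreviation "H \<equiv> hor_at M c d F"
abbreviation "\<Gamma> y \<equiv> conn N d (f y)"
abbreviation "sf \<equiv> second_fund_at M N c d F"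
abbreviation "T \<equiv> tension M N c d F"

text \<open>The direction is a vector, because \<open>nablaF\<close> depends on its field only
  through the value at the point; see \<open>nablaF_eq_D\<close>.\<close>

definition D :: "'e \<Rightarrow> ('e \<Rightarrow> 'f) \<Rightarrow> 'e \<Rightarrow> 'f" where
  "D u V = nablaF N c d F (\<lambda>_. u) V"

lemma S_subset: "S \<subseteq> cimg c"
  by (auto simp: ldom_def)

lemma f_in: "y \<in> S \<Longrightarrow> f y \<in> cimg d"
  by (auto simp: ldom_def loc_def cimg_def cdom_def)

lemma smooth_map: "smooth_map M N F"
  using rmap by (simp add: riemannian_map_def)

text \<open>\<open>S\<close> is the image, under the homeomorphism of the chart \<open>c\<close>, of
  the open set of points of \<open>cdom c\<close> that \<open>F\<close> maps into
  \<open>cdom d\<close>.\<close>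

lemma open_S: "open S"
proof -
  have hm: "homeomorphic_map (subtopology (topo M) (cdom c)) (top_of_set (cimg c)) (snd c)"
    and oc: "openin (topo M) (cdom c)"
    using src.chart by (simp_all add: is_chart_def)
  have od: "openin (topo N) (cdom d)"
    using tgt.chart by (simp add: is_chart_def)
  have contF: "continuous_map (topo M) (topo N) F"
    using smooth_map by (simp add: smooth_map_def)
  let ?W = "{a \<in> topspace (topo M). F a \<in> cdom d} \<inter> cdom c"
  have "openin (topo M) {a \<in> topspace (topo M). F a \<in> cdom d}"
    using contF od by (rule openin_continuous_map_preimage)
  then have "openin (subtopology (topo M) (cdom c)) ?W"
    by (auto simp: openin_subtopology)
  then have "openin (top_of_set (cimg c)) (snd c ` ?W)"
    using homeomorphic_imp_open_map[OF hm] by (simp add: open_map_def)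
  then have op: "open (snd c ` ?W)"
    using src.open_cimg by (rule openin_open_trans)
  have sub: "cdom c \<subseteq> topspace (topo M)" using oc by (rule openin_subset)
  have inj: "inj_on (snd c) (cdom c)"
    using homeomorphic_imp_injective_map[OF hm] sub by (simp add: topspace_subtopology Int_absorb1)
  have inv: "cinv c (snd c a) = a" if "a \<in> cdom c" for a
    using inj that by (simp add: cinv_def cdom_def)
  have "S = snd c ` ?W"
    using sub inv by (force simp: ldom_def cimg_def cdom_def image_iff)
  then show ?thesis using op by simp
qed

lemma Ck_f: "Ck_on k f S"
  using smooth_map src.atlas tgt.atlas by (auto simp: smooth_map_def smooth_on_def)

lemma f_has_derivative: "y \<in> S \<Longrightarrow> (f has_derivative Df y) (at y)"
  unfolding tmap_def by (rule Ck_on_has_derivative[OF open_S Ck_f])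

lemma linear_Df: "y \<in> S \<Longrightarrow> linear (Df y)"
  using f_has_derivative has_derivative_linear by blast

lemma Ck_Df: "Ck_on k (\<lambda>y. Df y u) S"
  using Ck_f[of "Suc k"] by (simp add: tmap_def)

lemma inner_g: "y \<in> S \<Longrightarrow> inner_form (g y)"
  using src.inner_form_metric S_subset by blast

lemma inner_h: "y \<in> S \<Longrightarrow> inner_form (h y)"
  using tgt.inner_form_metric f_in by blast

lemma Ck_\<Gamma>: "Ck_on k (\<lambda>y. \<Gamma> y u v) S"
  by (rule Ck_on_compose[OF open_S tgt.open_cimg Ck_f tgt.Ck_conn]) (use f_in in blast)

lemma bilinear_\<Gamma>: "y \<in> S \<Longrightarrow> bilinear (\<Gamma> y)"
  using f_in tgt.bilinear_conn by blast

lemma Ck_g: "Ck_on k (\<lambda>y. g y u v) S"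
  using src.Ck_metric S_subset by (rule Ck_on_subset)

lemma bilinear_conn_src: "y \<in> S \<Longrightarrow> bilinear (conn M c y)"
  using src.bilinear_conn S_subset by blast

lemma Ck_conn_src: "Ck_on k (\<lambda>y. conn M c y u v) S"
  using src.Ck_conn S_subset by (rule Ck_on_subset)

section \<open>The pullback connection\<close>

lemma nablaF_eq_D: "nablaF N c d F X V y = D (X y) V y"
  by (simp add: D_def nablaF_def)

lemma D_eq: "D u V y = frechet_derivative V (at y) u + \<Gamma> y (Df y u) (V y)"
  by (simp add: D_def nablaF_def)

lemma linear_D:
  assumes y: "y \<in> S" and V: "V differentiable at y"
  shows "linear (\<lambda>u. D u V y)"
proof -
  have "linear (\<lambda>u. \<Gamma> y (Df y u) (V y))"
    using linear_compose[OF linear_Df[OF y], of "\<lambda>u. \<Gamma> y u (V y)"] bilinear_\<Gamma>[OF y]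
    by (simp add: bilinear_def o_def)
  then show ?thesis
    unfolding D_eq by (intro linear_compose_add linear_frechet_derivative[OF V])
qed

lemma Ck_D: "Ck_on (Suc k) V S \<Longrightarrow> Ck_on k (D u V) S"
  unfolding D_eq[abs_def]
  by (intro Ck_on_add open_S Ck_on_bilinear_family[OF open_S bilinear_\<Gamma> Ck_\<Gamma>] Ck_Df)
    (auto intro: Ck_on_Suc_imp)

text \<open>Metric compatibility of the pullback connection: the chain rule along \<open>f\<close>
  turns the derivative of the target metric into Christoffel terms, which combine with the
  derivatives of \<open>V\<close> and \<open>W\<close>.\<close>

lemma h_has_derivative:
  assumes y: "y \<in> S" and V: "V differentiable at y" and W: "W differentiable at y"
  shows "((\<lambda>y. h y (V y) (W y)) has_derivative
    (\<lambda>u. h y (D u V y) (W y) + h y (V y) (D u W y))) (at y)"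
proof -
  interpret inner_form "h y" by (rule inner_h[OF y])
  have bil: "\<And>y. y \<in> S \<Longrightarrow> bilinear (h y)" using inner_h by (rule inner_form.bil)
  have "((\<lambda>y. h y v w) has_derivative
      (\<lambda>u. h y (\<Gamma> y (Df y u) v) w + h y v (\<Gamma> y (Df y u) w))) (at y)" for v w
    by (rule has_derivative_compose[OF f_has_derivative[OF y] tgt.metric_has_derivative[OF f_in[OF y]]])
  from has_derivative_bilinear_family[OF open_S y bil this
      V[unfolded frechet_derivative_works] W[unfolded frechet_derivative_works]]
  show ?thesis by (rule has_derivative_eq_rhs) (auto simp: D_eq simps)
qed

text \<open>An orthogonality relation that holds on all of \<open>S\<close> may be differentiated.
  It is applied to the pairs \<open>D e T\<close>, \<open>T\<close> and \<open>T\<close>,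
  \<open>Df y v\<close>.\<close>

lemma h_derivative_zero:
  assumes y: "y \<in> S" and V: "V differentiable at y" and W: "W differentiable at y"
    and zero: "\<And>z. z \<in> S \<Longrightarrow> h z (V z) (W z) = 0"
  shows "h y (D u V y) (W y) + h y (V y) (D u W y) = 0"
proof -
  have "((\<lambda>y. 0::real) has_derivative (\<lambda>u. h y (D u V y) (W y) + h y (V y) (D u W y))) (at y)"
    by (rule has_derivative_transform_within_open[OF h_has_derivative[OF y V W] open_S y zero])
  then have "(\<lambda>u. h y (D u V y) (W y) + h y (V y) (D u W y)) = (\<lambda>u. 0)"
    using has_derivative_const has_derivative_unique by blast
  then show ?thesis by metis
qed

section \<open>The second fundamental form and the tension field\<close>

lemma Df_differentiable: "y \<in> S \<Longrightarrow> (\<lambda>y. Df y u) differentiable at y"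
  using Ck_on_differentiable[OF open_S Ck_Df] .

lemma sf_eq: "sf y u v = D u (\<lambda>y. Df y v) y - Df y (conn M c y u v)"
  by (simp add: second_fund_at_def second_fund_def D_def src.nabla_const)

text \<open>The second derivatives of \<open>f\<close> commute, and the Christoffel symbols of both
  manifolds are symmetric.\<close>

lemma sf_sym:
  assumes "y \<in> S"
  shows "sf y u v = sf y v u"
  using symmetric_second_derivative[OF open_S Ck_f assms, of u v]
    src.levi_civita_const(1)[of y u v] tgt.levi_civita_const(1)[of "f y" "Df y u" "Df y v"] f_in assms S_subset
  by (auto simp: sf_eq D_eq tmap_def)

text \<open>Linearity in the first argument is read off from \<open>sf_eq\<close>; symmetry carries
  it over to the second.\<close>

lemma bilinear_sf:
  assumes y: "y \<in> S"
  shows "bilinear (sf y)"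
proof -
  have "linear (\<lambda>u. conn M c y u v)" for v using bilinear_conn_src[OF y] by (simp add: bilinear_def)
  then have "linear (\<lambda>u. Df y (conn M c y u v))" for v
    by (rule linear_compose[OF _ linear_Df[OF y], unfolded o_def])
  then have "linear (\<lambda>u. sf y u v)" for v
    unfolding sf_eq by (intro linear_compose_sub linear_D[OF y Df_differentiable[OF y]])
  then show ?thesis unfolding bilinear_def using sf_sym[OF y] by simp
qed

lemma Ck_sf: "Ck_on k (\<lambda>y. sf y u v) S"
  unfolding sf_eq
  by (intro Ck_on_diff open_S Ck_D Ck_Df Ck_on_linear_family[OF open_S linear_Df] Ck_conn_src)

text \<open>The basis inside \<open>trace_on\<close> is chosen independently at each point, so
  regularity cannot be seen from the definition. A frame depending regularly on the point, made from
  \<open>Basis\<close> by Gram-Schmidt, computes the same trace.\<close>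

lemma Ck_T: "Ck_on k T S"
proof -
  have "\<exists>E :: 'e \<Rightarrow> 'e \<Rightarrow> 'e. (\<forall>b\<in>Basis. Ck_on k (E b) S) \<and> (\<forall>y\<in>S.
      (\<forall>a\<in>Basis. \<forall>b\<in>Basis. g y (E a y) (E b y) = (if a = b then 1 else 0))
      \<and> span ((\<lambda>b. E b y) ` Basis) = span Basis)"
    by (rule smooth_orthonormal_frame[OF open_S inner_g Ck_g finite_Basis independent_Basis])
  then obtain E :: "'e \<Rightarrow> 'e \<Rightarrow> 'e" where E: "\<And>b. b \<in> Basis \<Longrightarrow> Ck_on k (E b) S"
    "\<And>y a b. y \<in> S \<Longrightarrow> a \<in> Basis \<Longrightarrow> b \<in> Basis \<Longrightarrow> g y (E a y) (E b y) = (if a = b then 1 else 0)"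
    "\<And>y. y \<in> S \<Longrightarrow> span ((\<lambda>b. E b y) ` Basis) = span Basis"
    by blast
  show ?thesis
  proof (rule Ck_on_cong[OF open_S])
    show "Ck_on k (\<lambda>y. \<Sum>b\<in>Basis. sf y (E b y) (E b y)) S"
      by (intro Ck_on_sum Ck_on_bilinear_family[OF open_S bilinear_sf Ck_sf] open_S E)
    fix y assume y: "y \<in> S"
    show "(\<Sum>b\<in>Basis. sf y (E b y) (E b y)) = T y"
      unfolding tension_def
      by (rule inner_form.trace_on_frame[OF inner_g[OF y], symmetric])
        (use E y bilinear_sf in auto)
  qed
qed

section \<open>Horizontal vectors and normality of the second fundamental form\<close>

lemma subspace_K: "y \<in> S \<Longrightarrow> subspace (K y)"
  using linear_subspace_kernel[OF linear_Df] by (simp add: ker_at_def)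

lemma subspace_H: "y \<in> S \<Longrightarrow> subspace (H y)"
  using inner_form.subspace_orth[OF inner_g] by (simp add: hor_at_def)

lemma vertical_horizontal:
  assumes y: "y \<in> S"
  obtains w where "w \<in> K y" "u - w \<in> H y" "Df y (u - w) = Df y u"
proof -
  obtain w where w: "w \<in> K y" "u - w \<in> H y"
    using inner_form.orthogonal_decomposition[OF inner_g subspace_K] y by (metis hor_at_def)
  then show ?thesis using that linear_diff[OF linear_Df[OF y]] by (simp add: ker_at_def)
qed

text \<open>Only one of the two vectors has to be horizontal: passing from \<open>v\<close> to its
  horizontal part changes neither side.\<close>

lemma h_Df:
  assumes y: "y \<in> S" and u: "u \<in> H y"
  shows "h y (Df y v) (Df y u) = g y v u"
proof -
  interpret inner_form "g y" by (rule inner_g[OF y])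
  obtain w where w: "w \<in> K y" "v - w \<in> H y" "Df y (v - w) = Df y v"
    using vertical_horizontal[OF y] .
  have "g y w u = 0" using u w sym by (auto simp: hor_at_def orth_def)
  moreover have "h y (Df y (v - w)) (Df y u) = g y (v - w) u"
    using rmap src.atlas tgt.atlas y u w(2) by (simp add: riemannian_map_def)
  ultimately show ?thesis by (simp add: w(3) simps)
qed

text \<open>Pythagoras: the differential kills the vertical part and preserves the norm of the
  horizontal part.\<close>

lemma h_Df_le:
  assumes y: "y \<in> S"
  shows "h y (Df y u) (Df y u) \<le> g y u u"
proof -
  interpret inner_form "g y" by (rule inner_g[OF y])
  obtain w where w: "w \<in> K y" "u - w \<in> H y" "Df y (u - w) = Df y u"
    using vertical_horizontal[OF y] .
  have "g y (u - w) w = 0" using w by (auto simp: hor_at_def orth_def)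
  then have "g y u u = g y (u - w) (u - w) + g y w w" using sym[of u w] by (simp add: simps)
  moreover have "h y (Df y u) (Df y u) = g y (u - w) (u - w)"
    using h_Df[OF y w(2), of "u - w"] by (simp add: w(3))
  ultimately show ?thesis using nonneg[of w] by simp
qed

text \<open>The extension of \<open>u\<close> with constant coordinates need not stay horizontal
  near \<open>x\<close>, so the isometry property cannot be differentiated directly. The inequality
  \<open>h_Df_le\<close> holds at every point and is an equality at \<open>x\<close>.\<close>

lemma sf_self_normal:
  assumes x: "x \<in> S" and u: "u \<in> H x"
  shows "h x (sf x w u) (Df x u) = 0"
proof -
  interpret gx: inner_form "g x" by (rule inner_g[OF x])
  interpret hx: inner_form "h x" by (rule inner_h[OF x])
  \<comment> \<open>\<open>?q\<close> is nonnegative and vanishes at \<open>x\<close>, so its derivative at \<open>x\<close> is zero.\<close>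
  let ?q = "\<lambda>y. g y u u - h y (Df y u) (Df y u)"
  have "(?q has_derivative (\<lambda>w. (g x (conn M c x w u) u + g x u (conn M c x w u))
      - (h x (D w (\<lambda>y. Df y u) x) (Df x u) + h x (Df x u) (D w (\<lambda>y. Df y u) x)))) (at x)"
    using S_subset x
    by (intro has_derivative_diff src.metric_has_derivative h_has_derivative Df_differentiable) auto
  moreover have "\<forall>y\<in>S. ?q x \<le> ?q y"
    using h_Df_le h_Df[OF x u, of u] by simp
  ultimately have "(\<lambda>w. (g x (conn M c x w u) u + g x u (conn M c x w u))
      - (h x (D w (\<lambda>y. Df y u) x) (Df x u) + h x (Df x u) (D w (\<lambda>y. Df y u) x))) = (\<lambda>w. 0)"
    using differential_zero_maxmin[OF x open_S] by blast
  then have "(g x (conn M c x w u) u + g x u (conn M c x w u))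
      - (h x (D w (\<lambda>y. Df y u) x) (Df x u) + h x (Df x u) (D w (\<lambda>y. Df y u) x)) = 0"
    by metis
  \<comment> \<open>\<open>h_Df\<close> rewrites the source Christoffel terms as products with
    \<open>Df x u\<close>; what remains is twice the claimed quantity.\<close>
  then show ?thesis
    using h_Df[OF x u, of "conn M c x w u"] gx.sym[of u] hx.sym[of "Df x u"] by (simp add: sf_eq hx.simps)
qed

text \<open>\<open>\<langle>(\<nabla>F\<^sub>*)(u, v), F\<^sub>* w\<rangle>\<close> is symmetric in \<open>u\<close>, \<open>v\<close> and, on horizontal vectors,
  skew in \<open>v\<close>, \<open>w\<close> by polarization of the preceding identity; hence it vanishes.\<close>

lemma sf_normal:
  assumes x: "x \<in> S" and u: "u \<in> H x" and v: "v \<in> H x"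
  shows "sf x u v \<in> range_perp_at N c d F x"
proof -
  interpret hx: inner_form "h x" by (rule inner_h[OF x])
  note bil = bilinear_ladd[OF bilinear_sf[OF x]] bilinear_radd[OF bilinear_sf[OF x]]
    linear_add[OF linear_Df[OF x]] hx.simps
  have skew: "h x (sf x w u) (Df x v) = - h x (sf x w v) (Df x u)" if "u \<in> H x" "v \<in> H x" for u v w
    using sf_self_normal[OF x subspace_add[OF subspace_H[OF x] that], of w]
      sf_self_normal[OF x that(1), of w] sf_self_normal[OF x that(2), of w]
    by (simp add: bil)
  have zero: "h x (sf x u v) (Df x w) = 0" if w: "w \<in> H x" for w
    using skew[OF v w, of u] skew[OF u w, of v] skew[OF u v, of w]
    unfolding sf_sym[OF x, of v u] sf_sym[OF x, of w u] sf_sym[OF x, of w v] by linarith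
  have "h x (sf x u v) (Df x w) = 0" for w
    using vertical_horizontal[OF x, of w] zero by metis
  then show ?thesis by (auto simp: range_perp_at_def range_at_def orth_def)
qed

section \<open>The tension field when the kernel is minimal\<close>

lemma trace_horizontal_normal:
  assumes x: "x \<in> S"
  shows "trace_on (g x) (H x) (sf x) \<in> range_perp_at N c d F x"
proof -
  interpret gx: inner_form "g x" by (rule inner_g[OF x])
  obtain E where E: "orthonormal_basis (g x) (H x) E"
    using gx.orthonormal_basis_exists[OF subspace_H[OF x]] by blast
  then have "E \<subseteq> H x" by (auto simp: orthonormal_basis_def intro: span_base)
  moreover have "subspace (range_perp_at N c d F x)"
    unfolding range_perp_at_def by (rule inner_form.subspace_orth[OF inner_h[OF x]])
  ultimately show ?thesis
    unfolding gx.trace_on_eq[OF E bilinear_sf[OF x]]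
    using sf_normal[OF x] by (blast intro: subspace_sum)
qed

lemma sf_vertical_frame:
  assumes x: "x \<in> U" and frame: "ker_frame M c d F U m e" and j: "j < m"
  shows "sf x (e j x) (e j x) = - Df x (nabla M c (e j) (e j) x)"
proof -
  have U: "open U" "U \<subseteq> S" and smooth: "smooth_on (e j) U"
    using frame j by (auto simp: ker_frame_def)
  have ker: "e j y \<in> K y" if "y \<in> U" for y
  proof -
    have "span ((\<lambda>i. e i y) ` {..<m}) = K y" using frame that by (simp add: ker_frame_def)
    then show ?thesis using j span_base[of "e j y" "(\<lambda>i. e i y) ` {..<m}"] by auto
  qed
  have xS: "x \<in> S" using x U by blast
  have Ck_e: "Ck_on (Suc 0) (e j) U" using smooth unfolding smooth_on_def by blast
  note e' = Ck_on_has_derivative[OF U(1) Ck_e x]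
  have "((\<lambda>y. Df y (e j y)) has_derivative (\<lambda>w. frechet_derivative (\<lambda>y. Df y (e j x)) (at x) w
      + Df x (frechet_derivative (e j) (at x) w))) (at x)"
    by (rule has_derivative_linear_family[OF open_S xS linear_Df _ e'])
      (use Df_differentiable[OF xS] frechet_derivative_works in blast)+
  moreover have "((\<lambda>y. Df y (e j y)) has_derivative (\<lambda>w. 0)) (at x)"
    by (rule has_derivative_transform_within_open[OF has_derivative_const U(1) x])
      (use ker in \<open>simp add: ker_at_def\<close>)
  ultimately have "(\<lambda>w. frechet_derivative (\<lambda>y. Df y (e j x)) (at x) w
      + Df x (frechet_derivative (e j) (at x) w)) = (\<lambda>w. 0)"
    by (rule has_derivative_unique)
  then have "frechet_derivative (\<lambda>y. Df y (e j x)) (at x) (e j x)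
      + Df x (frechet_derivative (e j) (at x) (e j x)) = 0"
    by metis
  then have "frechet_derivative (\<lambda>y. Df y (e j x)) (at x) (e j x)
      = - Df x (frechet_derivative (e j) (at x) (e j x))"
    by (simp add: eq_neg_iff_add_eq_0)
  moreover have "Df x (e j x) = 0" using ker[OF x] by (simp add: ker_at_def)
  ultimately show ?thesis
    using linear_add[OF linear_Df[OF xS]]
    by (simp add: sf_eq D_eq nabla_def bilinear_lzero[OF bilinear_\<Gamma>[OF xS]])
qed

text \<open>By \<open>sf_vertical_frame\<close> the vertical trace is minus the image of the sum of
  the derivatives \<open>nabla M c (e j) (e j) x\<close>. The differential sees only their
  horizontal parts, whose sum vanishes by minimality.\<close>

lemma trace_vertical_zero:
  assumes x: "x \<in> S" and min: "ker_mean_curvature M c d F x 0"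
  shows "trace_on (g x) (K x) (sf x) = 0"
proof -
  interpret gx: inner_form "g x" by (rule inner_g[OF x])
  obtain U m e where U: "x \<in> U" and frame: "ker_frame M c d F U m e"
    and mu: "0 = (1 / real m) *\<^sub>R (\<Sum>j<m. oproj (g x) (H x) (nabla M c (e j) (e j) x))"
    using min unfolding ker_mean_curvature_def by blast
  \<comment> \<open>For \<open>m = 0\<close> the factor \<open>1 / real m\<close> is 0 and says
    nothing, but then the sum is empty.\<close>
  have sum0: "(\<Sum>j<m. oproj (g x) (H x) (nabla M c (e j) (e j) x)) = 0"
    using mu by (cases "m = 0") auto
  have Df_oproj: "Df x (oproj (g x) (H x) u) = Df x u" for u
  proof -
    have "u - oproj (g x) (H x) u \<in> orth (g x) (H x)" using gx.oproj(2)[OF subspace_H[OF x]] .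
    then have "u - oproj (g x) (H x) u \<in> K x"
      by (simp add: hor_at_def gx.orth_orth[OF subspace_K[OF x]])
    then show ?thesis using linear_diff[OF linear_Df[OF x]] by (simp add: ker_at_def)
  qed
  have "trace_on (g x) (K x) (sf x) = (\<Sum>j<m. sf x (e j x) (e j x))"
    by (rule gx.trace_on_frame) (use frame U bilinear_sf[OF x] in \<open>auto simp: ker_frame_def\<close>)
  also have "\<dots> = (\<Sum>j<m. - Df x (oproj (g x) (H x) (nabla M c (e j) (e j) x)))"
    using sf_vertical_frame[OF U frame] by (simp add: Df_oproj)
  also have "\<dots> = - Df x (\<Sum>j<m. oproj (g x) (H x) (nabla M c (e j) (e j) x))"
    by (simp add: linear_sum[OF linear_Df[OF x]] sum_negf)
  finally show ?thesis using linear_0[OF linear_Df[OF x]] by (simp add: sum0)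
qed

lemma T_eq_trace_horizontal:
  assumes x: "x \<in> S" and min: "ker_mean_curvature M c d F x 0"
  shows "T x = trace_on (g x) (H x) (sf x)"
  using inner_form.trace_on_split[OF inner_g subspace_K bilinear_sf] trace_vertical_zero[OF x min] x
  by (simp add: tension_def hor_at_def)

text \<open>The factor is the reciprocal of the rank. As the rank is constant, a single
  \<open>r\<close> serves all of \<open>S\<close> and can be taken out of derivatives.\<close>

lemma mean_curvature_eq:
  assumes "\<And>y. y \<in> S \<Longrightarrow> ker_mean_curvature M c d F y 0"
  shows "\<exists>r>0. \<forall>y\<in>S. mean_curvature M N c d F y = r *\<^sub>R T y"
proof -
  obtain m :: nat where "m > 0" "\<And>y. y \<in> S \<Longrightarrow> dim (range_at c d F y) = m"
    using rmap src.atlas tgt.atlas unfolding riemannian_map_def by metis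
  then show ?thesis
    using assms by (intro exI[of _ "1 / real m"]) (simp add: mean_curvature_def T_eq_trace_horizontal)
qed

section \<open>Parallel mean curvature and the biharmonic equation\<close>

text \<open>As the normal projection of the derivative of the mean curvature is zero, that
  derivative is itself orthogonal to the normal space; division by \<open>r\<close> transfers this
  to \<open>T\<close>.\<close>

lemma D_T_normal_zero:
  assumes min: "\<And>y. y \<in> S \<Longrightarrow> ker_mean_curvature M c d F y 0"
    and par: "nablaF_perp N c d F (\<lambda>_. u) (mean_curvature M N c d F) x = 0"
    and x: "x \<in> S" and n: "n \<in> range_perp_at N c d F x"
  shows "h x (D u T x) n = 0"
proof -
  interpret hx: inner_form "h x" by (rule inner_h[OF x])
  let ?H = "mean_curvature M N c d F"
  obtain r where r: "r > 0" "\<And>y. y \<in> S \<Longrightarrow> ?H y = r *\<^sub>R T y"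
    using mean_curvature_eq[OF min] by blast
  have "((\<lambda>y. r *\<^sub>R T y) has_derivative (\<lambda>w. r *\<^sub>R frechet_derivative T (at x) w)) (at x)"
    by (intro has_derivative_scaleR_right Ck_on_has_derivative[OF open_S Ck_T x])
  then have "(?H has_derivative (\<lambda>w. r *\<^sub>R frechet_derivative T (at x) w)) (at x)"
    by (rule has_derivative_transform_within_open[OF _ open_S x]) (simp add: r(2))
  then have "frechet_derivative ?H (at x) = (\<lambda>w. r *\<^sub>R frechet_derivative T (at x) w)"
    by (rule frechet_derivative_at[symmetric])
  then have "D u ?H x = r *\<^sub>R D u T x"
    by (simp add: D_eq r(2)[OF x] bilinear_rmul[OF bilinear_\<Gamma>[OF x]] scaleR_add_right)
  moreover have "subspace (range_perp_at N c d F x)"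
    unfolding range_perp_at_def by (rule hx.subspace_orth)
  from hx.oproj(2)[OF this, of "D u ?H x"] par have "D u ?H x \<in> orth (h x) (range_perp_at N c d F x)"
    by (simp add: nablaF_perp_def nablaF_eq_D)
  ultimately have "h x (r *\<^sub>R D u T x) n = 0" using n by (simp add: orth_def)
  then show ?thesis using r(1) by (simp add: hx.simps)
qed

text \<open>Both traces in \<open>bitension\<close> are sums over the same chosen basis, so naming
  it \<open>E\<close> turns the pairing with \<open>T x\<close> into a single sum.\<close>

lemma bitension_T:
  assumes x: "x \<in> S" and sform: "space_form N k"
    and normal: "\<And>v. h x (T x) (Df x v) = 0"
    and D_T: "\<And>y u. y \<in> S \<Longrightarrow> h y (D u T y) (T y) = 0"
    and E: "E = (SOME E. orthonormal_basis (g x) UNIV E)"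
  shows "h x (bitension M N c d F x) (T x)
    = (\<Sum>e\<in>E. k * h x (T x) (T x) * h x (Df x e) (Df x e) - h x (D e T x) (D e T x))"
proof -
  interpret hx: inner_form "h x" by (rule inner_h[OF x])
  have T_diff: "T differentiable at y" and D_T_diff: "D u T differentiable at y" if "y \<in> S" for u y
    using Ck_on_differentiable[OF open_S Ck_T that] Ck_on_differentiable[OF open_S Ck_D[OF Ck_T] that] by blast+
  have hess: "h x (hessianF M N c d F (\<lambda>_. e) (\<lambda>_. e) T x) (T x) = - h x (D e T x) (D e T x)" for e
  proof -
    have "h x (D e (D e T) x) (T x) + h x (D e T x) (D e T x) = 0"
      by (rule h_derivative_zero[OF x D_T_diff[OF x] T_diff[OF x] D_T])
    moreover have "nablaF N c d F (\<lambda>_. e) T = D e T" by (simp add: D_def)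
    \<comment> \<open>The correction term of the Hessian is again a first derivative of
      \<open>T\<close>, hence orthogonal to \<open>T x\<close> by \<open>D_T\<close>.\<close>
    ultimately show ?thesis using D_T[OF x] by (simp add: hessianF_def nablaF_eq_D hx.simps)
  qed
  have curv: "h x (curv_at N d (f x) (Df x e) (T x) (Df x e)) (T x)
      = - k * h x (T x) (T x) * h x (Df x e) (Df x e)" for e
  proof -
    have "h x (Df x e) (T x) = 0" using normal[of e] by (simp add: hx.sym[of "Df x e"])
    from space_form_curvature[OF sform tgt.atlas f_in[OF x] this] show ?thesis
      by (simp only: mult.assoc mult.commute mult.left_commute)
  qed
  show ?thesis
    unfolding bitension_def laplaceF_def trace_on_def E[symmetric]
    by (simp add: hx.simps hx.sum_left hess curv sum_subtractf sum_negf)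
qed

lemma tension_zero:
  assumes sform: "space_form N k" and "k \<le> 0"
    and bih: "\<And>y. y \<in> S \<Longrightarrow> bitension M N c d F y = 0"
    and min: "\<And>y. y \<in> S \<Longrightarrow> ker_mean_curvature M c d F y 0"
    and par: "\<And>y u. y \<in> S \<Longrightarrow> nablaF_perp N c d F (\<lambda>_. u) (mean_curvature M N c d F) y = 0"
    and x: "x \<in> S"
  shows "T x = 0"
proof -
  have T_normal: "T y \<in> range_perp_at N c d F y" if "y \<in> S" for y
    using trace_horizontal_normal[OF that] T_eq_trace_horizontal[OF that min[OF that]] by simp
  have T_Df: "h y (T y) (Df y v) = 0" if "y \<in> S" for y v
    using T_normal[OF that] by (auto simp: range_perp_at_def range_at_def orth_def)
  have D_T: "h y (D u T y) (T y) = 0" if "y \<in> S" for y u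
    by (rule D_T_normal_zero[OF min par[OF that] that T_normal[OF that]])
  interpret gx: inner_form "g x" by (rule inner_g[OF x])
  interpret hx: inner_form "h x" by (rule inner_h[OF x])
  define E where "E = (SOME E. orthonormal_basis (g x) UNIV E)"
  have E: "orthonormal_basis (g x) UNIV E"
    unfolding E_def by (rule gx.some_orthonormal_basis[OF subspace_UNIV])
  have "h x (bitension M N c d F x) (T x) = 0" by (simp add: bih[OF x] hx.simps)
  then have "(\<Sum>e\<in>E. k * h x (T x) (T x) * h x (Df x e) (Df x e) - h x (D e T x) (D e T x)) = 0"
    using bitension_T[OF x sform T_Df[OF x] D_T E_def] by simp
  \<comment> \<open>The sign is reversed so that every summand is nonnegative when
    \<open>k \<le> 0\<close>; a vanishing sum then forces each summand to vanish.\<close>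
  then have sum0: "(\<Sum>e\<in>E. h x (D e T x) (D e T x) - k * (h x (T x) (T x) * h x (Df x e) (Df x e))) = 0"
    by (simp add: sum_subtractf mult.assoc)
  have curv_term: "k * (h x (T x) (T x) * h x (Df x e) (Df x e)) \<le> 0" for e
    using \<open>k \<le> 0\<close> hx.nonneg by (intro mult_nonpos_nonneg mult_nonneg_nonneg)
  have "D e T x = 0" if "e \<in> E" for e
  proof -
    have "h x (D e T x) (D e T x) - k * (h x (T x) (T x) * h x (Df x e) (Df x e)) \<ge> 0" for e
      using curv_term[of e] hx.nonneg[of "D e T x"] by linarith
    moreover have "finite E" using E by (simp add: orthonormal_basis_def)
    ultimately have "h x (D e T x) (D e T x) - k * (h x (T x) (T x) * h x (Df x e) (Df x e)) = 0"
      using sum0 that by (simp only: sum_nonneg_eq_0_iff)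
    then have "h x (D e T x) (D e T x) = 0"
      using curv_term[of e] hx.nonneg[of "D e T x"] by linarith
    then show ?thesis by (simp add: hx.eq_0_iff)
  qed
  \<comment> \<open>\<open>D u T x\<close> is linear in \<open>u\<close>, and \<open>E\<close> spans
    the whole tangent space.\<close>
  then have D_zero: "D u T x = 0" for u
    using linear_eq_0_on_span[OF linear_D[OF x Ck_on_differentiable[OF open_S Ck_T x]], of E u] E
    by (simp add: orthonormal_basis_def)
  \<comment> \<open>Here \<open>u\<close> and \<open>v\<close> are arbitrary, not only horizontal;
    the connection term in \<open>sf_eq\<close> is tangential and therefore orthogonal to
    \<open>T x\<close>.\<close>
  have "h x (T x) (sf x u v) = 0" for u v
  proof -
    have "h x (D u T x) (Df x v) + h x (T x) (D u (\<lambda>y. Df y v) x) = 0"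
      by (rule h_derivative_zero[OF x Ck_on_differentiable[OF open_S Ck_T x] Df_differentiable[OF x] T_Df])
    then show ?thesis by (simp add: D_zero sf_eq hx.simps T_Df[OF x])
  qed
  \<comment> \<open>\<open>T x\<close> is itself a sum of values of \<open>sf x\<close>.\<close>
  then have "h x (T x) (T x) = 0"
    by (simp add: tension_def trace_on_def hx.sum_right)
  then show ?thesis by (simp add: hx.eq_0_iff)
qed

end

section \<open>From one pair of charts to the whole manifold\<close>

theorem corollary4p2:
  fixes M1 :: "('a, 'e::euclidean_space) riem"
    and M2 :: "('b, 'f::euclidean_space) riem"
    and c :: real
  assumes "riemannian_manifold M1"
    and "space_form M2 c"
    and "c \<le> 0"
  shows "\<not> (\<exists>F. riemannian_map M1 M2 F
              \<and> proper_biharmonic M1 M2 F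
              \<and> pseudo_umbilical M1 M2 F
              \<and> minimal_kernel M1 M2 F
              \<and> parallel_mean_curvature M1 M2 F)"
proof (intro notI, elim exE conjE)
  fix F
  assume F: "riemannian_map M1 M2 F" "proper_biharmonic M1 M2 F" "minimal_kernel M1 M2 F"
    "parallel_mean_curvature M1 M2 F"
  \<comment> \<open>Harmonicity is a condition on each pair of charts, so an arbitrary pair may be
    fixed.\<close>
  have "tension M1 M2 a b F x = 0"
    if ab: "a \<in> atlas M1" "b \<in> atlas M2" and x: "x \<in> ldom a b F" for a b x
  proof -
    interpret riemannian_map_charts M1 a M2 b F
      using assms F ab by unfold_locales (simp_all add: space_form_def)
    show ?thesis
      by (rule tension_zero[OF assms(2,3) _ _ _ x])
        (use F ab in \<open>auto simp: proper_biharmonic_def biharmonic_def minimal_kernel_def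
          parallel_mean_curvature_def\<close>)
  qed
  then show False using F(2) by (auto simp: proper_biharmonic_def harmonic_def)
qed

end
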